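(* Let $\mathcal C$ be the category of all $R$-algebras with one product satisfying given relations $\mathcal R_1=0,\dots,\mathcal R_k=0$. Let $(A^\nu,\prec,\succ)$ be a formal deformation of a commutative $\mathcal C$-dendriform algebra $(A,\prec_0,\succ_0)$, with infinitesimal algebra $(A,\times,\bullet)$. Then $$(A,\times,\bullet)\in\underline{\mathcal C}^{\mathrm{dend}}_{\mathrm{pol}} .$$ In particular, when the relations of $\mathcal C^{\mathrm{dend}}_{\mathrm{pol}}$ are generated by weight homogeneous relations, then $(A,\times,\bullet)\in\mathcal C^{\mathrm{dend}}_{\mathrm{pol}}$. Also, when the relations of $\mathcal C$ are multilinear, $\underline{\mathcal C}^{\mathrm{dend}}_{\mathrm{pol}}=\bigl(\underline{\mathcal C}_{\mathrm{pol}}\bigr)^{\mathrm{dend}}$, so that $(A,\times,\bullet)\in\bigl(\underline{\mathcal C}_{\mathrm{pol}}\bigr)^{\mathrm{dend}}$.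
   Context: $R$ is a commutative ring in which $2$ is invertible. An algebra is an $R$-module with one or more bilinear products, with no further property assumed. A relation is an expression $\mathcal R(x_1,\dots,x_n)$, an $R$-linear combination of parenthesized monomials in the products at hand; an algebra satisfies $\mathcal R=0$ if $\mathcal R$ vanishes for all values of the variables. It is multilinear ($n$-linear) if every monomial contains each $x_1,\dots,x_n$ exactly once. **Dendriform algebras.** $(A,\prec,\succ)$ is a $\mathcal C$-dendriform algebra if $(A\times A,\boxtimes)\in\mathcal C$, where $(a,x)\boxtimes(b,y):=(a\prec b+a\succ b,\ a\succ y+x\prec b)$. It is commutative if $a\prec b=b\succ a$ for all $a,b$. **Polarized categories.** A polarized algebra $(A,\cdot,[\,,])$ has $\cdot$ commutative and $[\,,]$ anticommutative. $\mathcal C_{\mathrm{pol}}$ is the category of polarized algebras $(A,\cdot,[\,,])$ such that $(A,\mu)\in\mathcal C$ for $\mu(a,b):=a\cdot b+[a,b]$; its relations are those obtained from $\mathcal R_1,\dots,\mathcal R_k$ by replacing every product $ab$ by $a\cdot b+[a,b]$ (considered modulo commutativity of $\cdot$ and anticommutativity of $[\,,]$). For a category $\mathcal D$ of polarized algebras defined by relations, the corresponding category of polarized dendriform algebras consists of all algebras $(A,*,\circ)$ with two products such that $(A\times A,\odot,[\![\,,]\!])\in\mathcal D$, where $$(a,x)\odot(b,y):=(a*b+b*a,\ a*y+b*x),\qquad [\![(a,x),(b,y)]\!]:=(a\circ b-b\circ a,\ a\circ y-b\circ x).$$ For $\mathcal D=\mathcal C_{\mathrm{pol}}$ it is denoted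 $\mathcal C^{\mathrm{dend}}_{\mathrm{pol}}$; for $\mathcal D=\underline{\mathcal C}_{\mathrm{pol}}$ (below) it is denoted $(\underline{\mathcal C}_{\mathrm{pol}})^{\mathrm{dend}}$. The relations of $\mathcal C^{\mathrm{dend}}_{\mathrm{pol}}$ are the relations in $*,\circ$ obtained by writing out the components of each relation of $\mathcal C_{\mathrm{pol}}$ evaluated in $(A\times A,\odot,[\![\,,]\!])$; for an $n$-linear relation these are the $n$ relations obtained by substituting $(0,x_p)$ for the $p$-th variable and $(x_q,0)$ for the $q$-th variable for all $q\neq p$ ($p=1,\dots,n$) (the relation obtained by substituting $(x_q,0)$ for all variables follows from these). **Weight.** The weight of a monomial in $\cdot,[\,,]$ is the number of brackets $[\,,]$ in it; the weight of a monomial in $*,\circ$ is the number of operations $\circ$ in it. A linear combination of monomials of weight $m$ is called homogeneous of weight $m$. The lowest weight part of $\mathcal R$ is denoted $\underline{\mathcal R}$. $\underline{\mathcal C}_{\mathrm{pol}}$ (resp. $\underline{\mathcal C}^{\mathrm{dend}}_{\mathrm{pol}}$) is the category of all polarized algebras (resp. of all algebras $(A,*,\circ)$) satisfying $\underline{\mathcal R}=0$ for every $\mathcal R$ in the linear space of relations of $\mathcal C_{\mathrm{pol}}$ (resp. of $\mathcal C^{\mathrm{dend}}_{\mathrm{pol}}$), i.e. the $R$-module spanned by the relations just described, together with those obtained from them by permuting (renaming) the variables. "Generated by weight homogeneous relations" refers to this module. **Deformations.** Let $R^\nu=R[[\nu]]$ and $A^\nu=A[[\nu]]$; for $X\in A^\nu$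 let $X_0$ be its constant term. Let $(A,\prec_0,\succ_0)$ be a commutative $\mathcal C$-dendriform algebra and put $a\times b:=a\succ_0b=b\prec_0a$. An $R^\nu$-algebra $(A^\nu,\prec,\succ)$ is a formal deformation of $(A,\prec_0,\succ_0)$ if it is a $\mathcal C$-dendriform algebra over $R^\nu$ and $(a\succ b)_0=a\succ_0b$, $(a\prec b)_0=a\prec_0b$ for all $a,b\in A$. Its infinitesimal algebra is $(A,\times,\bullet)$, where for $a,b\in A$ $$a\bullet b:=\frac{a\succ b-b\prec a}{2\nu}\Big|_{\nu=0}.$$ Membership of $(A,\times,\bullet)$ in a category of algebras $(A,*,\circ)$ means with $*=\times$ and $\circ=\bullet$. *)

theory Defs
  imports
    "HOL-Library.Poly_Mapping"
    "HOL-Library.Product_Plus"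
    "HOL-Computational_Algebra.Formal_Power_Series"
begin

section \<open>Monomials, relations and their evaluation\<close>

text \<open>
  Parenthesized monomials in the variables \<open>x\<^sub>0, x\<^sub>1, \<dots>\<close>; the type \<open>'p\<close> lists the names of the
  products at hand. A relation is a finitely supported \<open>'r\<close>-linear combination of monomials,
  i.e. an element of the free algebra.
\<close>

datatype 'p mono = Var nat | Prod 'p "'p mono" "'p mono"

datatype pol_op = Dot | Br

datatype dend_op = Star | Circ

type_synonym ('p, 'r) rel = "'p mono \<Rightarrow>\<^sub>0 'r"

primrec mono_val :: "('p \<Rightarrow> 'a \<Rightarrow> 'a \<Rightarrow> 'a) \<Rightarrow> (nat \<Rightarrow> 'a) \<Rightarrow> 'p mono \<Rightarrow> 'a" where
  "mono_val ops \<rho> (Var i) = \<rho> i"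
| "mono_val ops \<rho> (Prod p s t) = ops p (mono_val ops \<rho> s) (mono_val ops \<rho> t)"

definition eval ::
  "('r::comm_ring_1 \<Rightarrow> 'a::ab_group_add \<Rightarrow> 'a) \<Rightarrow> ('p \<Rightarrow> 'a \<Rightarrow> 'a \<Rightarrow> 'a) \<Rightarrow> (nat \<Rightarrow> 'a) \<Rightarrow> ('p, 'r) rel \<Rightarrow> 'a"
  where "eval scale ops \<rho> P =
    (\<Sum>t\<in>Poly_Mapping.keys P. scale (Poly_Mapping.lookup P t) (mono_val ops \<rho> t))"

definition satisfies ::
  "('r::comm_ring_1 \<Rightarrow> 'a::ab_group_add \<Rightarrow> 'a) \<Rightarrow> ('p \<Rightarrow> 'a \<Rightarrow> 'a \<Rightarrow> 'a) \<Rightarrow> ('p, 'r) rel \<Rightarrow> bool"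
  where "satisfies scale ops P \<longleftrightarrow> (\<forall>\<rho>. eval scale ops \<rho> P = 0)"

primrec vars_mset :: "'p mono \<Rightarrow> nat multiset" where
  "vars_mset (Var i) = {#i#}"
| "vars_mset (Prod p s t) = vars_mset s + vars_mset t"

definition nlinear :: "nat \<Rightarrow> ('p, 'r::zero) rel \<Rightarrow> bool"
  where "nlinear n P \<longleftrightarrow> (\<forall>t\<in>Poly_Mapping.keys P. vars_mset t = mset_set {..<n})"

definition multilinear :: "('p, 'r::zero) rel \<Rightarrow> bool"
  where "multilinear P \<longleftrightarrow> (\<exists>n. nlinear n P)"

subsection \<open>The free algebra\<close>

definition gen :: "nat \<Rightarrow> ('p, 'r::comm_ring_1) rel"
  where "gen i = Poly_Mapping.single (Var i) 1"

definition free_scale :: "'r::comm_ring_1 \<Rightarrow> ('p, 'r) rel \<Rightarrow> ('p, 'r) rel"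
  where "free_scale c P = Poly_Mapping.map ((*) c) P"

definition free_mul :: "'p \<Rightarrow> ('p, 'r::comm_ring_1) rel \<Rightarrow> ('p, 'r) rel \<Rightarrow> ('p, 'r) rel"
  where "free_mul p P Q =
    (\<Sum>s\<in>Poly_Mapping.keys P. \<Sum>t\<in>Poly_Mapping.keys Q.
       Poly_Mapping.single (Prod p s t) (Poly_Mapping.lookup P s * Poly_Mapping.lookup Q t))"

lemma lookup_free_scale [simp]:
  "Poly_Mapping.lookup (free_scale c P) t = c * Poly_Mapping.lookup P t"
  by (simp add: free_scale_def Poly_Mapping.map.rep_eq when_def)

lemma module_free_scale: "module (free_scale :: 'r::comm_ring_1 \<Rightarrow> ('p, 'r) rel \<Rightarrow> ('p, 'r) rel)"
  by standard (auto intro!: poly_mapping_eqI simp: lookup_add algebra_simps)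

definition rename :: "(nat \<Rightarrow> nat) \<Rightarrow> ('p, 'r::comm_ring_1) rel \<Rightarrow> ('p, 'r) rel"
  where "rename \<sigma> P = eval free_scale free_mul (\<lambda>i. gen (\<sigma> i)) P"

text \<open>
  The linear space of relations spanned by given ones: permuting or renaming the finitely many
  variables of a relation is the same as applying a permutation of all variable names.
\<close>

definition rel_space :: "('p, 'r::comm_ring_1) rel set \<Rightarrow> ('p, 'r) rel set"
  where "rel_space G = module.span free_scale {rename \<sigma> P |\<sigma> P. bij \<sigma> \<and> P \<in> G}"

section \<open>Algebras and categories of algebras\<close>

definition bilinear_op ::
  "('r::comm_ring_1 \<Rightarrow> 'a::ab_group_add \<Rightarrow> 'a) \<Rightarrow> ('a \<Rightarrow> 'a \<Rightarrow> 'a) \<Rightarrow> bool"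
  where "bilinear_op scale mul \<longleftrightarrow>
    (\<forall>a. module_hom scale scale (\<lambda>b. mul a b)) \<and> (\<forall>b. module_hom scale scale (\<lambda>a. mul a b))"

text \<open>
  Categories are given by their membership predicates. In particular \<open>alg_cat Rs\<close> is the category
  \<open>\<C>\<close> with relations \<open>Rs\<close>. Note that \<^const>\<open>bilinear_op\<close> includes \<open>module scale\<close>.
\<close>

definition alg_cat ::
  "(unit, 'r::comm_ring_1) rel set \<Rightarrow> ('r \<Rightarrow> 'a::ab_group_add \<Rightarrow> 'a) \<Rightarrow> ('a \<Rightarrow> 'a \<Rightarrow> 'a) \<Rightarrow> bool"
  where "alg_cat Rs scale mul \<longleftrightarrow>
    bilinear_op scale mul \<and> (\<forall>P\<in>Rs. satisfies scale (\<lambda>_. mul) P)"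

definition prod_scale :: "('r \<Rightarrow> 'a \<Rightarrow> 'a) \<Rightarrow> 'r \<Rightarrow> 'a \<times> 'a \<Rightarrow> 'a \<times> 'a"
  where "prod_scale scale r = map_prod (scale r) (scale r)"

subsection \<open>Dendriform algebras\<close>

fun box_prod :: "('a \<Rightarrow> 'a \<Rightarrow> 'a::plus) \<Rightarrow> ('a \<Rightarrow> 'a \<Rightarrow> 'a) \<Rightarrow> 'a \<times> 'a \<Rightarrow> 'a \<times> 'a \<Rightarrow> 'a \<times> 'a"
  where "box_prod prec succ (a, x) (b, y) = (prec a b + succ a b, succ a y + prec x b)"

definition dendriform ::
  "(unit, 'r::comm_ring_1) rel set \<Rightarrow> ('r \<Rightarrow> 'a::ab_group_add \<Rightarrow> 'a)
    \<Rightarrow> ('a \<Rightarrow> 'a \<Rightarrow> 'a) \<Rightarrow> ('a \<Rightarrow> 'a \<Rightarrow> 'a) \<Rightarrow> bool"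
  where "dendriform Rs scale prec succ \<longleftrightarrow>
    bilinear_op scale prec \<and> bilinear_op scale succ \<and>
    alg_cat Rs (prod_scale scale) (box_prod prec succ)"

definition comm_dendriform ::
  "(unit, 'r::comm_ring_1) rel set \<Rightarrow> ('r \<Rightarrow> 'a::ab_group_add \<Rightarrow> 'a)
    \<Rightarrow> ('a \<Rightarrow> 'a \<Rightarrow> 'a) \<Rightarrow> ('a \<Rightarrow> 'a \<Rightarrow> 'a) \<Rightarrow> bool"
  where "comm_dendriform Rs scale prec succ \<longleftrightarrow>
    dendriform Rs scale prec succ \<and> (\<forall>a b. prec a b = succ b a)"

subsection \<open>Polarized algebras and polarized dendriform algebras\<close>

definition polarized ::
  "('r::comm_ring_1 \<Rightarrow> 'a::ab_group_add \<Rightarrow> 'a) \<Rightarrow> ('a \<Rightarrow> 'a \<Rightarrow> 'a) \<Rightarrow> ('a \<Rightarrow> 'a \<Rightarrow> 'a) \<Rightarrow> bool"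
  where "polarized scale dot br \<longleftrightarrow>
    bilinear_op scale dot \<and> bilinear_op scale br \<and>
    (\<forall>a b. dot a b = dot b a) \<and> (\<forall>a b. br a b = - br b a)"

definition pol_cat ::
  "(unit, 'r::comm_ring_1) rel set \<Rightarrow> ('r \<Rightarrow> 'a::ab_group_add \<Rightarrow> 'a)
    \<Rightarrow> ('a \<Rightarrow> 'a \<Rightarrow> 'a) \<Rightarrow> ('a \<Rightarrow> 'a \<Rightarrow> 'a) \<Rightarrow> bool"
  where "pol_cat Rs scale dot br \<longleftrightarrow>
    polarized scale dot br \<and> alg_cat Rs scale (\<lambda>a b. dot a b + br a b)"

fun sq_dot :: "('a \<Rightarrow> 'a \<Rightarrow> 'a::plus) \<Rightarrow> 'a \<times> 'a \<Rightarrow> 'a \<times> 'a \<Rightarrow> 'a \<times> 'a"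
  where "sq_dot star (a, x) (b, y) = (star a b + star b a, star a y + star b x)"

fun sq_br :: "('a \<Rightarrow> 'a \<Rightarrow> 'a::minus) \<Rightarrow> 'a \<times> 'a \<Rightarrow> 'a \<times> 'a \<Rightarrow> 'a \<times> 'a"
  where "sq_br circ (a, x) (b, y) = (circ a b - circ b a, circ a y - circ b x)"

definition pol_dend ::
  "(('r::comm_ring_1 \<Rightarrow> 'a::ab_group_add \<times> 'a \<Rightarrow> 'a \<times> 'a)
      \<Rightarrow> ('a \<times> 'a \<Rightarrow> 'a \<times> 'a \<Rightarrow> 'a \<times> 'a) \<Rightarrow> ('a \<times> 'a \<Rightarrow> 'a \<times> 'a \<Rightarrow> 'a \<times> 'a) \<Rightarrow> bool)
    \<Rightarrow> ('r \<Rightarrow> 'a \<Rightarrow> 'a) \<Rightarrow> ('a \<Rightarrow> 'a \<Rightarrow> 'a) \<Rightarrow> ('a \<Rightarrow> 'a \<Rightarrow> 'a) \<Rightarrow> bool"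
  where "pol_dend D scale star circ \<longleftrightarrow>
    bilinear_op scale star \<and> bilinear_op scale circ \<and>
    D (prod_scale scale) (sq_dot star) (sq_br circ)"

section \<open>Relations of the polarized categories\<close>

definition pol_rel :: "(unit, 'r::comm_ring_1) rel \<Rightarrow> (pol_op, 'r) rel"
  where "pol_rel P = eval free_scale (\<lambda>_ a b. free_mul Dot a b + free_mul Br a b) gen P"

text \<open>
  Relations of polarized algebras are considered modulo the ideal generated by commutativity and
  anticommutativity; they are represented by elements of the free algebra with two products.
\<close>

inductive_set pol_ideal :: "(pol_op, 'r::comm_ring_1) rel set" where
  comm: "free_mul Dot P Q - free_mul Dot Q P \<in> pol_ideal"
| anticomm: "free_mul Br P Q + free_mul Br Q P \<in> pol_ideal"
| zero: "0 \<in> pol_ideal"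
| add: "P \<in> pol_ideal \<Longrightarrow> Q \<in> pol_ideal \<Longrightarrow> P + Q \<in> pol_ideal"
| scale: "P \<in> pol_ideal \<Longrightarrow> free_scale c P \<in> pol_ideal"
| mul_left: "P \<in> pol_ideal \<Longrightarrow> free_mul p Q P \<in> pol_ideal"
| mul_right: "P \<in> pol_ideal \<Longrightarrow> free_mul p P Q \<in> pol_ideal"

text \<open>
  Evaluation of a polarized relation in the algebra \<open>F \<times> F\<close>, where \<open>F\<close> is the free algebra with
  products \<open>*\<close> and \<open>\<circ>\<close>.
\<close>

definition dend_eval ::
  "(nat \<Rightarrow> (dend_op, 'r) rel \<times> (dend_op, 'r) rel) \<Rightarrow> (pol_op, 'r::comm_ring_1) rel
    \<Rightarrow> (dend_op, 'r) rel \<times> (dend_op, 'r) rel"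
  where "dend_eval \<rho> P =
    eval (prod_scale free_scale)
      (\<lambda>p. case p of Dot \<Rightarrow> sq_dot (free_mul Star) | Br \<Rightarrow> sq_br (free_mul Circ)) \<rho> P"

text \<open>
  An \<open>n\<close>-linear relation gives the \<open>n\<close> relations obtained from \<open>(0, x\<^sub>p)\<close> and \<open>(x\<^sub>q, 0)\<close>, \<open>q \<noteq> p\<close>, whose
  first components vanish. Any other relation gives the two components of its value on generic
  pairs \<open>(a\<^sub>i, y\<^sub>i)\<close>, with \<open>a\<^sub>i = x\<^bsub>2i\<^esub>\<close> and \<open>y\<^sub>i = x\<^bsub>2i+1\<^esub>\<close>.
\<close>

definition dend_rels :: "(pol_op, 'r::comm_ring_1) rel \<Rightarrow> (dend_op, 'r) rel set"
  where "dend_rels P =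
    (if multilinear P
     then {snd (dend_eval (\<lambda>q. if q = p then (0, gen p) else (gen q, 0)) P) |n p. nlinear n P \<and> p < n}
     else {fst (dend_eval (\<lambda>i. (gen (2 * i), gen (2 * i + 1))) P),
           snd (dend_eval (\<lambda>i. (gen (2 * i), gen (2 * i + 1))) P)})"

definition pol_relations :: "(unit, 'r::comm_ring_1) rel set \<Rightarrow> (pol_op, 'r) rel set"
  where "pol_relations Rs = rel_space (pol_rel ` Rs)"

definition dend_relations :: "(unit, 'r::comm_ring_1) rel set \<Rightarrow> (dend_op, 'r) rel set"
  where "dend_relations Rs = rel_space (\<Union>P\<in>Rs. dend_rels (pol_rel P))"

section \<open>Weight\<close>

text \<open>The weight is the number of operations \<open>w\<close>, with \<open>w = Br\<close>, respectively \<open>w = Circ\<close>.\<close>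

primrec weight :: "'p \<Rightarrow> 'p mono \<Rightarrow> nat" where
  "weight w (Var i) = 0"
| "weight w (Prod p s t) = (if p = w then 1 else 0) + weight w s + weight w t"

definition homogeneous :: "'p \<Rightarrow> nat \<Rightarrow> ('p, 'r::zero) rel \<Rightarrow> bool"
  where "homogeneous w m P \<longleftrightarrow> (\<forall>t\<in>Poly_Mapping.keys P. weight w t = m)"

definition weight_part :: "'p \<Rightarrow> nat \<Rightarrow> ('p, 'r::comm_ring_1) rel \<Rightarrow> ('p, 'r) rel"
  where "weight_part w m P =
    (\<Sum>t\<in>{t \<in> Poly_Mapping.keys P. weight w t = m}. Poly_Mapping.single t (Poly_Mapping.lookup P t))"

text \<open>
  Representative of the lowest weight part of the class of \<open>P\<close> modulo the (weight graded)
  submodule \<open>N\<close>.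
\<close>

definition lowest_part :: "'p \<Rightarrow> ('p, 'r::comm_ring_1) rel set \<Rightarrow> ('p, 'r) rel \<Rightarrow> ('p, 'r) rel"
  where "lowest_part w N P =
    (if P \<in> N then 0 else weight_part w (LEAST m. weight_part w m P \<notin> N) P)"

definition ul_pol_cat ::
  "(unit, 'r::comm_ring_1) rel set \<Rightarrow> ('r \<Rightarrow> 'a::ab_group_add \<Rightarrow> 'a)
    \<Rightarrow> ('a \<Rightarrow> 'a \<Rightarrow> 'a) \<Rightarrow> ('a \<Rightarrow> 'a \<Rightarrow> 'a) \<Rightarrow> bool"
  where "ul_pol_cat Rs scale dot br \<longleftrightarrow>
    polarized scale dot br \<and>
    (\<forall>P\<in>pol_relations Rs.
       satisfies scale (\<lambda>p. case p of Dot \<Rightarrow> dot | Br \<Rightarrow> br) (lowest_part Br pol_ideal P))"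

definition ul_dend_cat ::
  "(unit, 'r::comm_ring_1) rel set \<Rightarrow> ('r \<Rightarrow> 'a::ab_group_add \<Rightarrow> 'a)
    \<Rightarrow> ('a \<Rightarrow> 'a \<Rightarrow> 'a) \<Rightarrow> ('a \<Rightarrow> 'a \<Rightarrow> 'a) \<Rightarrow> bool"
  where "ul_dend_cat Rs scale star circ \<longleftrightarrow>
    bilinear_op scale star \<and> bilinear_op scale circ \<and>
    (\<forall>P\<in>dend_relations Rs.
       satisfies scale (\<lambda>p. case p of Star \<Rightarrow> star | Circ \<Rightarrow> circ) (lowest_part Circ {0} P))"

definition weight_generated :: "(dend_op, 'r::comm_ring_1) rel set \<Rightarrow> bool"
  where "weight_generated M \<longleftrightarrow>
    (\<exists>H. (\<forall>P\<in>H. \<exists>m. homogeneous Circ m P) \<and> M = module.span free_scale H)"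

section \<open>Formal deformations\<close>

text \<open>The \<open>R[[\<nu>]]\<close>-module \<open>A[[\<nu>]]\<close>, with \<open>\<nu>\<close> being \<^const>\<open>fps_X\<close>.\<close>

definition fps_scale ::
  "('r::comm_ring_1 \<Rightarrow> 'a::ab_group_add \<Rightarrow> 'a) \<Rightarrow> 'r fps \<Rightarrow> 'a fps \<Rightarrow> 'a fps"
  where "fps_scale scale c X = Abs_fps (\<lambda>n. \<Sum>i=0..n. scale (fps_nth c i) (fps_nth X (n - i)))"

text \<open>Over \<open>R[[\<nu>]]\<close>, the category \<open>\<C>\<close> is defined by the same relations, via \<open>R \<subseteq> R[[\<nu>]]\<close>.\<close>

definition formal_deformation ::
  "(unit, 'r::comm_ring_1) rel set \<Rightarrow> ('r \<Rightarrow> 'a::ab_group_add \<Rightarrow> 'a)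
    \<Rightarrow> ('a \<Rightarrow> 'a \<Rightarrow> 'a) \<Rightarrow> ('a \<Rightarrow> 'a \<Rightarrow> 'a)
    \<Rightarrow> ('a fps \<Rightarrow> 'a fps \<Rightarrow> 'a fps) \<Rightarrow> ('a fps \<Rightarrow> 'a fps \<Rightarrow> 'a fps) \<Rightarrow> bool"
  where "formal_deformation Rs scale prec0 succ0 prec succ \<longleftrightarrow>
    dendriform (Poly_Mapping.map fps_const ` Rs) (fps_scale scale) prec succ \<and>
    (\<forall>a b. fps_nth (succ (fps_const a) (fps_const b)) 0 = succ0 a b) \<and>
    (\<forall>a b. fps_nth (prec (fps_const a) (fps_const b)) 0 = prec0 a b)"

definition infinitesimal_op ::
  "('r::comm_ring_1 \<Rightarrow> 'a::ab_group_add \<Rightarrow> 'a)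
    \<Rightarrow> ('a fps \<Rightarrow> 'a fps \<Rightarrow> 'a fps) \<Rightarrow> ('a fps \<Rightarrow> 'a fps \<Rightarrow> 'a fps) \<Rightarrow> 'a \<Rightarrow> 'a \<Rightarrow> 'a"
  where "infinitesimal_op scale prec succ a b =
    fps_nth (THE Y. fps_scale scale (2 * fps_X) Y =
      succ (fps_const a) (fps_const b) - prec (fps_const b) (fps_const a)) 0"

end

theory Submission
  imports Defs
begin

text \<open>
  On \<open>A[[\<nu>]]\<close> put \<open>a * b = (a \<succ> b + b \<prec> a) / 2\<close> and \<open>a \<circ> b = (a \<succ> b - b \<prec> a) / 2\<close>. Then \<open>\<boxtimes>\<close> is the sum of
  the products built from \<open>*\<close> and \<open>\<circ>\<close>, so \<open>(A[[\<nu>]], *, \<circ>)\<close> satisfies all relations of the polarized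
  dendriform category. Since \<open>a * b = a \<times> b + O(\<nu>)\<close> and \<open>a \<circ> b = \<nu> (a \<bullet> b) + O(\<nu>\<^sup>2)\<close>, a monomial of weight \<open>m\<close>
  has leading term \<open>\<nu>\<^sup>m\<close> times its value in \<open>(A, \<times>, \<bullet>)\<close>; the lowest coefficient of a relation is
  therefore the value of its lowest weight part.

  For a multilinear relation \<open>P\<close>, let \<open>D\<^sub>p P\<close> be the dendriform relation obtained from \<open>(0, x\<^sub>p)\<close> and
  \<open>(x\<^sub>q, 0)\<close>, \<open>q \<noteq> p\<close>. The map \<open>D\<^sub>p\<close> preserves the weight, and all monomials of \<open>D\<^sub>p P\<close> end with \<open>x\<^sub>p\<close>, so that
  the images of different \<open>D\<^sub>p\<close> do not interact. As \<open>2\<close> is invertible, \<open>P\<close> can be recovered from \<open>D\<^sub>p P\<close>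
  modulo (anti)commutativity. Hence taking lowest weight parts commutes with \<open>D\<^sub>p\<close>.
\<close>

section \<open>Evaluation in the free algebra\<close>

interpretation free: module "free_scale :: 'r::comm_ring_1 \<Rightarrow> ('p, 'r) rel \<Rightarrow> ('p, 'r) rel"
  by (rule module_free_scale)

abbreviation monom :: "'p mono \<Rightarrow> ('p, 'r::comm_ring_1) rel"
  where "monom t \<equiv> Poly_Mapping.single t 1"

section \<open>Consequences of bilinearity\<close>

lemma bilinear_opI:
  assumes "module scale"
    and "\<And>a b c. mul (a + b) c = mul a c + mul b c" "\<And>a b c. mul a (b + c) = mul a b + mul a c"
    and "\<And>r a b. mul (scale r a) b = scale r (mul a b)" "\<And>r a b. mul a (scale r b) = scale r (mul a b)"
  shows "bilinear_op scale mul"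
  using assms by (auto simp: bilinear_op_def module_hom_def module_hom_axioms_def)

lemma bilinear_op_module: "bilinear_op scale mul \<Longrightarrow> module scale"
  by (auto simp: bilinear_op_def module_hom_def)

lemma
  assumes "bilinear_op scale mul"
  shows bilinear_op_hom_right: "module_hom scale scale (\<lambda>b. mul a b)"
    and bilinear_op_hom_left: "module_hom scale scale (\<lambda>a. mul a b)"
  using assms by (auto simp: bilinear_op_def)

lemma bilinear_op_simps:
  assumes "bilinear_op scale mul"
  shows "mul (a + b) c = mul a c + mul b c" "mul a (b + c) = mul a b + mul a c"
    and "mul (scale r a) b = scale r (mul a b)" "mul a (scale r b) = scale r (mul a b)"
    and "mul 0 a = 0" "mul a 0 = 0" "mul (- a) b = - mul a b" "mul a (- b) = - mul a b"
    and "mul (a - b) c = mul a c - mul b c" "mul a (b - c) = mul a b - mul a c"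
  using module_hom.add[OF bilinear_op_hom_left[OF assms]] module_hom.add[OF bilinear_op_hom_right[OF assms]]
    module_hom.scale[OF bilinear_op_hom_left[OF assms]] module_hom.scale[OF bilinear_op_hom_right[OF assms]]
    module_hom.zero[OF bilinear_op_hom_left[OF assms]] module_hom.zero[OF bilinear_op_hom_right[OF assms]]
    module_hom.neg[OF bilinear_op_hom_left[OF assms]] module_hom.neg[OF bilinear_op_hom_right[OF assms]]
    module_hom.diff[OF bilinear_op_hom_left[OF assms]] module_hom.diff[OF bilinear_op_hom_right[OF assms]]
  by simp_all

section \<open>Evaluation as a linear map and as a homomorphism\<close>

lemma eval_superset:
  assumes "module scale" "finite K" "Poly_Mapping.keys P \<subseteq> K"
  shows "eval scale ops \<rho> P = (\<Sum>t\<in>K. scale (Poly_Mapping.lookup P t) (mono_val ops \<rho> t))"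
  unfolding eval_def using assms(2,3)
  by (intro sum.mono_neutral_left)
    (auto simp: not_in_keys_iff_lookup_eq_zero module.scale_zero_left[OF assms(1)])

lemma module_hom_eval:
  assumes "module scale"
  shows "module_hom free_scale scale (eval scale ops \<rho>)"
proof -
  interpret module scale by fact
  have "eval scale ops \<rho> (P + Q) = eval scale ops \<rho> P + eval scale ops \<rho> Q" for P Q
  proof -
    let ?K = "Poly_Mapping.keys P \<union> Poly_Mapping.keys Q"
    have "eval scale ops \<rho> X = (\<Sum>t\<in>?K. scale (Poly_Mapping.lookup X t) (mono_val ops \<rho> t))"
      if "X \<in> {P, Q, P + Q}" for X
      using that Poly_Mapping.keys_add[of P Q] by (intro eval_superset[OF assms]) auto
    then show ?thesis
      by (simp add: lookup_add scale_left_distrib sum.distrib)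
  qed
  moreover have "eval scale ops \<rho> (free_scale c P) = scale c (eval scale ops \<rho> P)" for c P
  proof -
    have "Poly_Mapping.keys (free_scale c P) \<subseteq> Poly_Mapping.keys P"
      by (auto simp: in_keys_iff)
    then have "eval scale ops \<rho> (free_scale c P)
        = (\<Sum>t\<in>Poly_Mapping.keys P. scale (c * Poly_Mapping.lookup P t) (mono_val ops \<rho> t))"
      by (subst eval_superset[OF assms finite_keys]) simp_all
    then show ?thesis
      by (simp add: eval_def scale_sum_right)
  qed
  ultimately show ?thesis
    by (simp add: module_hom_def module_hom_axioms_def assms module_free_scale)
qed

lemma eval_monom: "module scale \<Longrightarrow> eval scale ops \<rho> (monom t) = mono_val ops \<rho> t"
  using module.scale_one[of scale] by (simp add: eval_def)

lemma eval_single: "module scale \<Longrightarrow> eval scale ops \<rho> (Poly_Mapping.single t c) = scale c (mono_val ops \<rho> t)"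
  using module.scale_zero_left[of scale] by (simp add: eval_def)

lemma eval_gen: "module scale \<Longrightarrow> eval scale ops \<rho> (gen i) = \<rho> i"
  by (simp add: gen_def eval_monom)

text \<open>Homomorphisms commute with the value of each monomial, hence with linear combinations.
  This is the means of comparing values of one relation in different algebras.\<close>

lemma eval_hom_comp:
  assumes "module_hom s1 s2 f" "\<And>p a b. f (ops1 p a b) = ops2 p (f a) (f b)"
  shows "f (eval s1 ops1 \<rho> P) = eval s2 ops2 (\<lambda>i. f (\<rho> i)) P"
proof -
  have "f (mono_val ops1 \<rho> t) = mono_val ops2 (\<lambda>i. f (\<rho> i)) t" for t
    by (induction t) (auto simp: assms(2))
  then show ?thesis
    by (simp add: eval_def module_hom.sum[OF assms(1)] module_hom.scale[OF assms(1)])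
qed

text \<open>Together with linearity and \<open>eval_gen\<close> this is the universal property of
  the free algebra: evaluation is the homomorphism that sends the generators to \<rho>.\<close>

lemma eval_free_mul:
  assumes "bilinear_op scale (ops p)"
  shows "eval scale ops \<rho> (free_mul p P Q) = ops p (eval scale ops \<rho> P) (eval scale ops \<rho> Q)"
proof -
  note m = bilinear_op_module[OF assms]
  note hl = bilinear_op_hom_left[OF assms] and hr = bilinear_op_hom_right[OF assms]
  show ?thesis
    unfolding free_mul_def module_hom.sum[OF module_hom_eval[OF m]] eval_single[OF m]
    unfolding eval_def module_hom.sum[OF hl]
    by (simp add: module_hom.sum[OF hr] module_hom.scale[OF hr] module_hom.scale[OF hl]
        module.scale_scale[OF m] module.scale_sum_right[OF m] mult.commute sum.swap[of _ "Poly_Mapping.keys P"])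
qed

section \<open>Bilinearity of the free product and the basis of monomials\<close>

lemma free_mul_superset:
  assumes "finite K" "Poly_Mapping.keys P \<subseteq> K" "finite L" "Poly_Mapping.keys Q \<subseteq> L"
  shows "free_mul p P Q = (\<Sum>s\<in>K. \<Sum>t\<in>L.
    Poly_Mapping.single (Prod p s t) (Poly_Mapping.lookup P s * Poly_Mapping.lookup Q t))"
proof -
  have "free_mul p P Q = (\<Sum>s\<in>K. \<Sum>t\<in>Poly_Mapping.keys Q.
    Poly_Mapping.single (Prod p s t) (Poly_Mapping.lookup P s * Poly_Mapping.lookup Q t))"
    unfolding free_mul_def using assms by (intro sum.mono_neutral_left) (auto simp: in_keys_iff)
  also have "\<dots> = (\<Sum>s\<in>K. \<Sum>t\<in>L.
    Poly_Mapping.single (Prod p s t) (Poly_Mapping.lookup P s * Poly_Mapping.lookup Q t))"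
    using assms by (intro sum.cong sum.mono_neutral_left) (auto simp: in_keys_iff)
  finally show ?thesis .
qed

lemma free_scale_single: "free_scale c (Poly_Mapping.single t d) = Poly_Mapping.single t (c * d)"
  by (rule poly_mapping_eqI) (simp add: lookup_single when_def)

lemma bilinear_free_mul:
  fixes p :: 'a
  shows "bilinear_op (free_scale :: 'b::comm_ring_1 \<Rightarrow> ('a, 'b) rel \<Rightarrow> ('a, 'b) rel) (free_mul p)"
proof (rule bilinear_opI[OF module_free_scale])
  fix a b c :: "('a, 'b::comm_ring_1) rel" and r :: 'b
  let ?K = "Poly_Mapping.keys a \<union> Poly_Mapping.keys b" and ?L = "Poly_Mapping.keys c"
  have k: "Poly_Mapping.keys (a + b) \<subseteq> ?K" by (rule Poly_Mapping.keys_add)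
  show "free_mul p (a + b) c = free_mul p a c + free_mul p b c"
    using k by (simp add: free_mul_superset[of ?K _ ?L] lookup_add distrib_right single_add sum.distrib)
  show "free_mul p c (a + b) = free_mul p c a + free_mul p c b"
    using k by (simp add: free_mul_superset[of ?L _ ?K] lookup_add distrib_left single_add sum.distrib)
  have k: "Poly_Mapping.keys (free_scale r a) \<subseteq> ?K" "Poly_Mapping.keys (free_scale r c) \<subseteq> ?L"
    by (auto simp: in_keys_iff)
  show "free_mul p (free_scale r a) c = free_scale r (free_mul p a c)"
    using k by (simp add: free_mul_superset[of ?K _ ?L] free.scale_sum_right free_scale_single mult.assoc)
  show "free_mul p a (free_scale r c) = free_scale r (free_mul p a c)"
    using k by (simp add: free_mul_superset[of ?K _ ?L] free.scale_sum_right free_scale_single mult.left_commute)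
qed

lemma mono_val_free_mul: "mono_val free_mul gen t = (monom t :: ('p, 'r::comm_ring_1) rel)"
  by (induction t) (auto simp: gen_def free_mul_def)

lemma eval_free_mul_gen: "eval free_scale free_mul gen P = P"
  by (rule poly_mapping_eqI)
    (simp add: eval_def mono_val_free_mul free_scale_single lookup_sum lookup_single when_def
      in_keys_iff)

lemma sum_monom: "P = (\<Sum>t\<in>Poly_Mapping.keys P. free_scale (Poly_Mapping.lookup P t) (monom t))"
  using eval_free_mul_gen[of P] by (simp add: eval_def mono_val_free_mul)

lemma module_hom_eq_on_monoms:
  assumes "module_hom free_scale s f" "module_hom free_scale s g"
    and "\<And>t. t \<in> Poly_Mapping.keys P \<Longrightarrow> f (monom t) = g (monom t)"
  shows "f P = g P"
proof -
  have "f P = (\<Sum>t\<in>Poly_Mapping.keys P. s (Poly_Mapping.lookup P t) (f (monom t)))"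
    by (subst sum_monom[of P])
      (simp add: module_hom.sum[OF assms(1)] module_hom.scale[OF assms(1)])
  also have "\<dots> = g P"
    by (subst (2) sum_monom[of P])
      (simp add: module_hom.sum[OF assms(2)] module_hom.scale[OF assms(2)] assms(3))
  finally show ?thesis .
qed

section \<open>Componentwise module structure on pairs\<close>

lemma module_prod_scale:
  assumes "module scale"
  shows "module (prod_scale scale)"
proof -
  interpret module scale by fact
  show ?thesis
    by standard (auto simp: prod_scale_def scale_right_distrib scale_left_distrib)
qed

lemma fst_prod_scale [simp]: "fst (prod_scale scale r u) = scale r (fst u)"
  and snd_prod_scale [simp]: "snd (prod_scale scale r u) = scale r (snd u)"
  by (simp_all add: prod_scale_def)

lemma module_hom_snd: "module scale \<Longrightarrow> module_hom (prod_scale scale) scale snd"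
  by (simp add: module_hom_def module_hom_axioms_def module_prod_scale)

lemma module_hom_map_prod:
  "module_hom s1 s2 f \<Longrightarrow> module_hom (prod_scale s1) (prod_scale s2) (map_prod f f)"
  by (auto simp: module_hom_def module_hom_axioms_def module_prod_scale prod_scale_def)

section \<open>Squares of algebras\<close>

abbreviation sq :: "('a \<Rightarrow> 'a \<Rightarrow> 'a::ab_group_add) \<Rightarrow> ('a \<Rightarrow> 'a \<Rightarrow> 'a)
    \<Rightarrow> pol_op \<Rightarrow> 'a \<times> 'a \<Rightarrow> 'a \<times> 'a \<Rightarrow> 'a \<times> 'a"
  where "sq star circ \<equiv> case_pol_op (sq_dot star) (sq_br circ)"

lemma sq_dot_conv: "sq_dot star u v = (star (fst u) (fst v) + star (fst v) (fst u), star (fst u) (snd v) + star (fst v) (snd u))"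
  and sq_br_conv: "sq_br circ u v = (circ (fst u) (fst v) - circ (fst v) (fst u), circ (fst u) (snd v) - circ (fst v) (snd u))"
  by (cases u; cases v; simp)+

lemma polarized_sq:
  assumes "bilinear_op scale star" "bilinear_op scale circ"
  shows "polarized (prod_scale scale) (sq_dot star) (sq_br circ)"
proof -
  note m = bilinear_op_module[OF assms(1)]
  note simps = bilinear_op_simps[OF assms(1)] bilinear_op_simps[OF assms(2)]
    module.scale_right_distrib[OF m] module.scale_right_diff_distrib[OF m]
  show ?thesis
    unfolding polarized_def
    by (intro conjI bilinear_opI module_prod_scale m allI)
      (auto simp: sq_dot_conv sq_br_conv prod_eq_iff simps algebra_simps)
qed

lemma bilinear_sq:
  assumes "bilinear_op scale star" "bilinear_op scale circ"
  shows "bilinear_op (prod_scale scale) (sq star circ p)"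
  using polarized_sq[OF assms] by (cases p) (auto simp: polarized_def)

lemma bilinear_case_dend_op:
  "bilinear_op scale star \<Longrightarrow> bilinear_op scale circ \<Longrightarrow> bilinear_op scale (case_dend_op star circ p)"
  by (cases p) auto

text \<open>Applying a homomorphism of algebras to both components is a homomorphism between their
  squares. Hence evaluating first in the square of the free algebra and then in the given algebra is
  evaluating directly in the square of the latter.\<close>

lemma eval_dend_eval:
  fixes \<rho>
  assumes "bilinear_op scale star" "bilinear_op scale circ"
  defines "e \<equiv> eval scale (case_dend_op star circ) \<rho>"
  shows "map_prod e e (dend_eval \<rho>' P) = eval (prod_scale scale) (sq star circ) (\<lambda>i. map_prod e e (\<rho>' i)) P"
proof -
  have hom: "module_hom free_scale scale e"
    unfolding e_def by (intro module_hom_eval bilinear_op_module[OF assms(1)])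
  have mul: "e (free_mul p a b) = case_dend_op star circ p (e a) (e b)" for p a b
    unfolding e_def by (intro eval_free_mul bilinear_case_dend_op assms)
  show ?thesis
    unfolding dend_eval_def
    by (rule eval_hom_comp[OF module_hom_map_prod[OF hom]])
      (auto simp: sq_dot_conv sq_br_conv prod_eq_iff mul module_hom.add[OF hom] module_hom.diff[OF hom]
        split: pol_op.splits)
qed

section \<open>Evaluation under renaming, polarization and passage to spans\<close>

lemma eval_rename:
  assumes "\<And>p. bilinear_op scale (ops p)"
  shows "eval scale ops \<rho> (rename \<sigma> P) = eval scale ops (\<lambda>i. \<rho> (\<sigma> i)) P"
proof -
  have m: "module scale" using assms bilinear_op_module by blast
  show ?thesis
    unfolding rename_def
    by (subst eval_hom_comp[OF module_hom_eval[OF m], where ?ops2.0 = ops])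
      (simp_all add: eval_free_mul[of scale ops, OF assms] eval_gen[OF m])
qed

lemma eval_pol_rel:
  assumes "bilinear_op scale (ops Dot)" "bilinear_op scale (ops Br)"
  shows "eval scale ops \<rho> (pol_rel P) = eval scale (\<lambda>_ a b. ops Dot a b + ops Br a b) \<rho> P"
proof -
  note m = bilinear_op_module[OF assms(1)]
  show ?thesis
    unfolding pol_rel_def
    by (subst eval_hom_comp[OF module_hom_eval[OF m], where ?ops2.0 = "\<lambda>_ a b. ops Dot a b + ops Br a b"])
      (simp_all add: module_hom.add[OF module_hom_eval[OF m]] eval_free_mul[of scale ops, OF assms(1)]
        eval_free_mul[of scale ops, OF assms(2)] eval_gen[OF m])
qed

lemma satisfies_span:
  assumes "module scale" "\<And>P. P \<in> G \<Longrightarrow> satisfies scale ops P" "P \<in> module.span free_scale G"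
  shows "satisfies scale ops P"
proof -
  note hom = module_hom_eval[OF assms(1), of ops]
  have "free.subspace {P. satisfies scale ops P}"
    by (rule free.subspaceI)
      (auto simp: satisfies_def module_hom.zero[OF hom] module_hom.add[OF hom] module_hom.scale[OF hom]
        module.scale_zero_right[OF assms(1)])
  with free.span_minimal[of G "{P. satisfies scale ops P}"] assms(2,3) show ?thesis by auto
qed

text \<open>Renaming variables only reindexes the assignment, and the relations that hold in an
  algebra form a submodule.\<close>

lemma satisfies_rel_space:
  assumes "\<And>p. bilinear_op scale (ops p)" "\<And>P. P \<in> G \<Longrightarrow> satisfies scale ops P" "P \<in> rel_space G"
  shows "satisfies scale ops P"
  using assms(3) bilinear_op_module[OF assms(1)] assms(2) unfolding rel_space_def
  by (elim satisfies_span[rotated 2]) (auto simp: satisfies_def eval_rename[OF assms(1)])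

lemma rel_space_superset: "G \<subseteq> rel_space G"
proof
  fix P assume "P \<in> G"
  moreover have "rename id P = P" by (simp add: rename_def eval_free_mul_gen)
  ultimately show "P \<in> rel_space G"
    unfolding rel_space_def by (intro free.span_base) (metis (mono_tags, lifting) CollectI bij_id)
qed

lemma eval_pol_ideal:
  assumes "polarized scale (ops Dot) (ops Br)" "P \<in> pol_ideal"
  shows "eval scale ops \<rho> P = 0"
proof -
  have b: "bilinear_op scale (ops p)" for p using assms(1) by (cases p) (auto simp: polarized_def)
  note m = bilinear_op_module[OF b]
  note hom = module_hom_eval[OF m, of ops \<rho>]
  from assms(1) have "ops Dot a c = ops Dot c a" "ops Br a c = - ops Br c a" for a c
    unfolding polarized_def by blast+
  then have "ops Dot a c - ops Dot c a = 0" "ops Br a c + ops Br c a = 0" for a c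
    by (metis diff_self, metis add.left_inverse)
  with assms(2) show ?thesis
    by (induction)
      (simp_all add: module_hom.zero[OF hom] module_hom.add[OF hom] module_hom.diff[OF hom]
        module_hom.scale[OF hom] module.scale_zero_right[OF m] eval_free_mul[of scale ops, OF b] bilinear_op_simps[OF b])
qed

section \<open>Restriction to a set of monomials\<close>

text \<open>The selecting predicate is arbitrary, because relations are split both by weight and by
  their last variable.\<close>

definition restr :: "('p mono \<Rightarrow> bool) \<Rightarrow> ('p, 'r::comm_ring_1) rel \<Rightarrow> ('p, 'r) rel"
  where "restr \<Phi> P =
    (\<Sum>t\<in>{t \<in> Poly_Mapping.keys P. \<Phi> t}. Poly_Mapping.single t (Poly_Mapping.lookup P t))"

lemma weight_part_eq_restr: "weight_part w m = restr (\<lambda>t. weight w t = m)"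
  by (simp add: fun_eq_iff weight_part_def restr_def)

lemma lookup_restr: "Poly_Mapping.lookup (restr \<Phi> P) t = (if \<Phi> t then Poly_Mapping.lookup P t else 0)"
  by (auto simp: restr_def lookup_sum lookup_single when_def in_keys_iff)

lemma keys_restr: "Poly_Mapping.keys (restr \<Phi> P) = {t \<in> Poly_Mapping.keys P. \<Phi> t}"
  by (auto simp: in_keys_iff lookup_restr split: if_splits)

lemma module_hom_restr: "module_hom free_scale free_scale (restr \<Phi>)"
  by (simp add: module_hom_def module_hom_axioms_def module_free_scale poly_mapping_eq_iff fun_eq_iff
      lookup_restr lookup_add)

lemma restr_eq_self: "(\<And>t. t \<in> Poly_Mapping.keys P \<Longrightarrow> \<Phi> t) \<Longrightarrow> restr \<Phi> P = P"
  and restr_eq_0: "(\<And>t. t \<in> Poly_Mapping.keys P \<Longrightarrow> \<not> \<Phi> t) \<Longrightarrow> restr \<Phi> P = 0"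
  by (auto simp: poly_mapping_eq_iff fun_eq_iff lookup_restr in_keys_iff)

lemma restr_commute: "restr \<Phi> (restr \<Psi> P) = restr \<Psi> (restr \<Phi> P)"
  by (simp add: poly_mapping_eq_iff fun_eq_iff lookup_restr)

lemma sum_restr_fibres: "(\<Sum>k\<in>f ` Poly_Mapping.keys P. restr (\<lambda>t. f t = k) P) = P"
proof (rule poly_mapping_eqI)
  fix t
  show "Poly_Mapping.lookup (\<Sum>k\<in>f ` Poly_Mapping.keys P. restr (\<lambda>t. f t = k) P) t = Poly_Mapping.lookup P t"
    by (auto simp: lookup_sum lookup_restr in_keys_iff)
qed

lemma weight_part_monom:
  "weight_part w m (monom t) = (if weight w t = m then monom t else 0)"
  by (auto simp: weight_part_eq_restr intro!: restr_eq_self restr_eq_0)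

section \<open>Supports of products and of evaluated relations\<close>

lemma keys_free_mul:
  assumes "u \<in> Poly_Mapping.keys (free_mul p P Q)"
  obtains s t where "u = Prod p s t" "s \<in> Poly_Mapping.keys P" "t \<in> Poly_Mapping.keys Q"
proof -
  obtain s where s: "s \<in> Poly_Mapping.keys P" "u \<in> Poly_Mapping.keys (\<Sum>t\<in>Poly_Mapping.keys Q.
      Poly_Mapping.single (Prod p s t) (Poly_Mapping.lookup P s * Poly_Mapping.lookup Q t))"
    using subsetD[OF Poly_Mapping.keys_sum assms[unfolded free_mul_def]] by blast
  obtain t where t: "t \<in> Poly_Mapping.keys Q"
    "u \<in> Poly_Mapping.keys (Poly_Mapping.single (Prod p s t) (Poly_Mapping.lookup P s * Poly_Mapping.lookup Q t))"
    using subsetD[OF Poly_Mapping.keys_sum s(2)] by blast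
  from t(2) have "u = Prod p s t" by (simp split: if_splits)
  with s(1) t(1) show ?thesis using that by blast
qed

lemma keys_free_mul_subset:
  assumes "Poly_Mapping.keys P \<subseteq> A" "Poly_Mapping.keys Q \<subseteq> B"
    and "\<And>s t. s \<in> A \<Longrightarrow> t \<in> B \<Longrightarrow> Prod q s t \<in> C"
  shows "Poly_Mapping.keys (free_mul q P Q) \<subseteq> C"
  using assms by (blast elim: keys_free_mul)

lemmas keys_add_subset = order_trans[OF Poly_Mapping.keys_add Un_least]
  and keys_diff_subset = order_trans[OF Poly_Mapping.keys_diff Un_least]

lemma keys_eval:
  assumes "u \<in> Poly_Mapping.keys (eval free_scale ops \<rho> P)"
  obtains t where "t \<in> Poly_Mapping.keys P" "u \<in> Poly_Mapping.keys (mono_val ops \<rho> t)"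
proof -
  obtain t where t: "t \<in> Poly_Mapping.keys P"
    "u \<in> Poly_Mapping.keys (free_scale (Poly_Mapping.lookup P t) (mono_val ops \<rho> t))"
    using subsetD[OF Poly_Mapping.keys_sum assms[unfolded eval_def]] by blast
  from t(2) have "u \<in> Poly_Mapping.keys (mono_val ops \<rho> t)"
    unfolding in_keys_iff lookup_free_scale by force
  with t(1) show ?thesis using that by blast
qed

lemma nlinear_pol_rel:
  assumes "nlinear n P"
  shows "nlinear n (pol_rel P)"
proof -
  let ?ops = "\<lambda>(_::unit) a b. free_mul Dot a b + free_mul Br a b :: (pol_op, 'a) rel"
  have vars: "Poly_Mapping.keys (mono_val ?ops gen t) \<subseteq> {u. vars_mset u = vars_mset t}" for t
  proof (induction t)
    case (Prod q s t)
    show ?case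
      unfolding mono_val.simps
      by (intro keys_add_subset; rule keys_free_mul_subset, rule Prod.IH, rule Prod.IH, force)
  qed (simp add: gen_def)
  show ?thesis
    unfolding nlinear_def
  proof
    fix u assume "u \<in> Poly_Mapping.keys (pol_rel P)"
    then obtain t where t: "t \<in> Poly_Mapping.keys P" "u \<in> Poly_Mapping.keys (mono_val ?ops gen t)"
      unfolding pol_rel_def by (rule keys_eval)
    with vars[of t] assms show "vars_mset u = mset_set {..<n}" by (auto simp: nlinear_def)
  qed
qed

lemma vars_mset_rename:
  assumes "nlinear n P" "u \<in> Poly_Mapping.keys (rename \<sigma> P)"
  shows "vars_mset u = image_mset \<sigma> (mset_set {..<n})"
proof -
  have *: "Poly_Mapping.keys (mono_val free_mul (\<lambda>i. gen (\<sigma> i) :: ('a, 'b) rel) t)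
    \<subseteq> {u. vars_mset u = image_mset \<sigma> (vars_mset t)}" for t
  proof (induction t)
    case (Prod q s t)
    show ?case
      unfolding mono_val.simps by (rule keys_free_mul_subset, rule Prod.IH, rule Prod.IH) force
  qed (simp add: gen_def)
  from assms(2) obtain t where "t \<in> Poly_Mapping.keys P"
    "u \<in> Poly_Mapping.keys (mono_val free_mul (\<lambda>i. gen (\<sigma> i) :: ('a, 'b) rel) t)"
    unfolding rename_def by (rule keys_eval)
  with *[of t] assms(1) show ?thesis by (auto simp: nlinear_def)
qed

section \<open>The dendriform relations of a polarized relation\<close>

text \<open>This is the map \<open>D\<^sub>p\<close> of the overview, defined for every
  \<open>p\<close> and for every relation so that it is linear on the whole free algebra.\<close>

definition dpart :: "nat \<Rightarrow> (pol_op, 'r::comm_ring_1) rel \<Rightarrow> (dend_op, 'r) rel"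
  where "dpart p P = snd (dend_eval (\<lambda>q. if q = p then (0, gen p) else (gen q, 0)) P)"

lemma case_dend_op_free_mul: "case_dend_op (free_mul Star) (free_mul Circ) = free_mul"
  by (auto simp: fun_eq_iff split: dend_op.splits)

lemma dend_eval_conv: "dend_eval \<rho> = eval (prod_scale free_scale) (sq (free_mul Star) (free_mul Circ)) \<rho>"
  by (simp add: dend_eval_def fun_eq_iff)

lemma module_hom_dpart: "module_hom free_scale free_scale (dpart p)"
  unfolding dpart_def[abs_def] dend_eval_conv
  using module_hom_compose[OF module_hom_eval[OF module_prod_scale[OF module_free_scale]]
      module_hom_snd[OF module_free_scale]]
  by (simp add: o_def)

lemmas dpart_zero = module_hom.zero[OF module_hom_dpart]

lemma eval_dpart:
  assumes "bilinear_op scale star" "bilinear_op scale circ"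
  shows "eval scale (case_dend_op star circ) \<rho> (dpart p P) =
    snd (eval (prod_scale scale) (sq star circ) (\<lambda>q. if q = p then (0, \<rho> p) else (\<rho> q, 0)) P)"
proof -
  note m = bilinear_op_module[OF assms(1)]
  let ?e = "eval scale (case_dend_op star circ) \<rho>"
  have "(\<lambda>q. map_prod ?e ?e (if q = p then (0, gen p) else (gen q, 0)))
      = (\<lambda>q. if q = p then (0, \<rho> p) else (\<rho> q, 0))"
    by (auto simp: eval_gen[OF m] module_hom.zero[OF module_hom_eval[OF m]])
  with eval_dend_eval[OF assms, of \<rho> "\<lambda>q. if q = p then (0, gen p) else (gen q, 0)" P]
  show ?thesis by (simp add: dpart_def prod_eq_iff)
qed

text \<open>Injectivity of \<sigma> ensures that the distinguished variable \<open>p\<close> is the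
  only one that becomes \<open>\<sigma> p\<close>.\<close>

lemma dpart_rename:
  assumes "inj \<sigma>"
  shows "dpart (\<sigma> p) (rename \<sigma> P) = rename \<sigma> (dpart p P)"
proof -
  have "rename \<sigma> (dpart p P) = snd (dend_eval
      (\<lambda>q. if q = p then (0, gen (\<sigma> p)) else (gen (\<sigma> q), 0)) P)"
    unfolding rename_def dend_eval_conv
    using eval_dpart[OF bilinear_free_mul bilinear_free_mul, of Star Circ "\<lambda>i. gen (\<sigma> i)" p P]
    by (simp add: case_dend_op_free_mul)
  also have "\<dots> = dpart (\<sigma> p) (rename \<sigma> P)"
    unfolding dpart_def dend_eval_conv
    by (subst eval_rename[OF bilinear_sq[OF bilinear_free_mul bilinear_free_mul]])
      (simp add: inj_eq[OF assms])
  finally show ?thesis ..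
qed

section \<open>Values of monomials at pairs\<close>

lemma fst_mono_val_sq:
  assumes "\<And>i. i \<in># vars_mset t \<Longrightarrow> fst (\<rho> i) = fst (\<rho>' i)"
  shows "fst (mono_val (sq star circ) \<rho> t) = fst (mono_val (sq star circ) \<rho>' t)"
  using assms by (induction t) (auto simp: sq_dot_conv sq_br_conv split: pol_op.splits)

lemma snd_mono_val_sq:
  assumes "bilinear_op scale star" "bilinear_op scale circ"
    and "\<And>i. i \<in># vars_mset t \<Longrightarrow> snd (\<rho> i) = 0"
  shows "snd (mono_val (sq star circ) \<rho> t) = 0"
  using assms(3)
  by (induction t)
    (auto simp: sq_dot_conv sq_br_conv bilinear_op_simps[OF assms(1)] bilinear_op_simps[OF assms(2)]
      split: pol_op.splits)

lemma diag_mono_val_sq: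
  "snd (mono_val (sq star circ) (\<lambda>i. (a i, a i)) t) = fst (mono_val (sq star circ) (\<lambda>i. (a i, a i)) t)"
  by (induction t) (auto simp: sq_dot_conv sq_br_conv split: pol_op.splits)

text \<open>Both square products act like a split extension: their second components are linear in
  the second entries. When no variable is repeated, the second component therefore splits into the
  contributions of the single second entries, and erasing the first entry at \<open>p\<close> does
  not disturb the contribution of \<open>p\<close>.\<close>

lemma snd_mono_val_sq_sum:
  fixes \<rho> :: "nat \<Rightarrow> 'a::ab_group_add \<times> 'a"
  assumes "bilinear_op scale star" "bilinear_op scale circ" "finite V"
    and "set_mset (vars_mset t) \<subseteq> V" "\<And>i. count (vars_mset t) i \<le> 1"
  defines "\<rho>' \<equiv> \<lambda>p q. if q = p then (0, snd (\<rho> p)) else (fst (\<rho> q), 0)"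
  shows "snd (mono_val (sq star circ) \<rho> t) = (\<Sum>p\<in>V. snd (mono_val (sq star circ) (\<rho>' p) t))"
  using assms(4,5)
proof (induction t)
  case (Var i)
  have "(\<Sum>p\<in>V. snd (\<rho>' p i)) = (\<Sum>p\<in>{i}. snd (\<rho>' p i))"
    using Var assms(3) by (intro sum.mono_neutral_right) (auto simp: \<rho>'_def)
  then show ?case by (simp add: \<rho>'_def)
next
  case (Prod o' s t)
  let ?v = "mono_val (sq star circ)"
  have le: "count (vars_mset s) i \<le> 1" "count (vars_mset t) i \<le> 1" for i
    using Prod.prems(2)[of i] by auto
  have IH: "snd (?v \<rho> s) = (\<Sum>p\<in>V. snd (?v (\<rho>' p) s))" "snd (?v \<rho> t) = (\<Sum>p\<in>V. snd (?v (\<rho>' p) t))"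
    using Prod.IH Prod.prems(1) le by auto
  have z: "snd (?v (\<rho>' p) r) = 0" if "p \<notin># vars_mset r" for p r
    by (rule snd_mono_val_sq[OF assms(1,2)]) (use that in \<open>auto simp: \<rho>'_def\<close>)
  have f: "fst (?v (\<rho>' p) r) = fst (?v \<rho> r)" if "p \<notin># vars_mset r" for p r
    by (rule fst_mono_val_sq) (use that in \<open>auto simp: \<rho>'_def\<close>)
  \<comment> \<open>Since \<open>p\<close> is missing from one factor, either the first component of
    \<open>s\<close> is unaffected by erasing the entry at \<open>p\<close>, or the second component
    of \<open>t\<close> vanishes; the same holds with \<open>s\<close> and \<open>t\<close>
    exchanged.\<close>
  have disj: "p \<notin># vars_mset s \<or> p \<notin># vars_mset t" for p
    using Prod.prems(2)[of p] by (auto simp flip: count_greater_zero_iff)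
  note simps = bilinear_op_simps(5,6)[OF assms(1)] bilinear_op_simps(5,6)[OF assms(2)]
  have "star (fst (?v (\<rho>' p) s)) (snd (?v (\<rho>' p) t)) = star (fst (?v \<rho> s)) (snd (?v (\<rho>' p) t))"
    "circ (fst (?v (\<rho>' p) s)) (snd (?v (\<rho>' p) t)) = circ (fst (?v \<rho> s)) (snd (?v (\<rho>' p) t))"
    "star (fst (?v (\<rho>' p) t)) (snd (?v (\<rho>' p) s)) = star (fst (?v \<rho> t)) (snd (?v (\<rho>' p) s))"
    "circ (fst (?v (\<rho>' p) t)) (snd (?v (\<rho>' p) s)) = circ (fst (?v \<rho> t)) (snd (?v (\<rho>' p) s))" for p
    using disj[of p] f z by (auto simp: simps)
  then show ?case
    by (cases o') (simp_all add: sq_dot_conv sq_br_conv IH sum.distrib sum_subtractf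
        module_hom.sum[OF bilinear_op_hom_right[OF assms(1)]] module_hom.sum[OF bilinear_op_hom_right[OF assms(2)]])
qed

text \<open>The second component of a value is a sum of values of the \<open>dpart p P\<close>. The
  first component reduces to the second by restricting to the diagonal.\<close>

lemma satisfies_sq_if_dpart:
  fixes P :: "(pol_op, 'r::comm_ring_1) rel" and scale :: "'r \<Rightarrow> 'a::ab_group_add \<Rightarrow> 'a"
  assumes "bilinear_op scale star" "bilinear_op scale circ"
    and "\<And>t i. t \<in> Poly_Mapping.keys P \<Longrightarrow> count (vars_mset t) i \<le> 1"
    and sat: "\<And>p. satisfies scale (case_dend_op star circ) (dpart p P)"
  shows "satisfies (prod_scale scale) (sq star circ) P"
proof -
  let ?e = "\<lambda>\<rho>. eval (prod_scale scale) (sq star circ) \<rho> P"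
  have snd: "snd (?e \<rho>) = 0" for \<rho>
  proof -
    define V where "V = (\<Union>t\<in>Poly_Mapping.keys P. set_mset (vars_mset t))"
    define \<rho>' where "\<rho>' = (\<lambda>p q. if q = p then (0, snd (\<rho> p)) else (fst (\<rho> q), 0))"
    have V: "finite V" by (simp add: V_def)
    have "snd (?e \<rho>) = (\<Sum>t\<in>Poly_Mapping.keys P. scale (Poly_Mapping.lookup P t)
        (\<Sum>p\<in>V. snd (mono_val (sq star circ) (\<rho>' p) t)))"
      unfolding eval_def snd_sum snd_prod_scale \<rho>'_def
      by (intro sum.cong refl arg_cong[where f = "scale _"] snd_mono_val_sq_sum[OF assms(1,2) V])
        (use assms(3) in \<open>auto simp: V_def\<close>)
    also have "\<dots> = (\<Sum>p\<in>V. snd (?e (\<rho>' p)))"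
      by (simp add: eval_def snd_sum module.scale_sum_right[OF bilinear_op_module[OF assms(1)]]
          sum.swap[of _ V])
    also have "\<dots> = 0"
    proof (intro sum.neutral ballI)
      fix p
      \<comment> \<open>\<open>eval_dpart\<close> takes a single assignment, so the second entry at
        \<open>p\<close> and the first entries elsewhere are merged into one.\<close>
      have "(\<lambda>q. if q = p then (0, if p = p then snd (\<rho> p) else fst (\<rho> p))
          else (if q = p then snd (\<rho> p) else fst (\<rho> q), 0)) = \<rho>' p"
        by (auto simp: \<rho>'_def)
      with eval_dpart[OF assms(1,2), of "\<lambda>q. if q = p then snd (\<rho> p) else fst (\<rho> q)" p P]
        sat[of p] show "snd (?e (\<rho>' p)) = 0"
        by (simp add: satisfies_def)
    qed
    finally show ?thesis .
  qed
  \<comment> \<open>The diagonal is a subalgebra, and the first component does not depend on the \<open>x\<^sub>i\<close>.\<close>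
  have fst: "fst (?e \<rho>) = 0" for \<rho>
  proof -
    have "fst (?e \<rho>) = fst (?e (\<lambda>i. (fst (\<rho> i), fst (\<rho> i))))"
      unfolding eval_def fst_sum fst_prod_scale
      by (intro sum.cong refl arg_cong[where f = "scale _"] fst_mono_val_sq) simp
    also have "\<dots> = snd (?e (\<lambda>i. (fst (\<rho> i), fst (\<rho> i))))"
      unfolding eval_def fst_sum fst_prod_scale snd_sum snd_prod_scale diag_mono_val_sq ..
    finally show ?thesis using snd by simp
  qed
  show ?thesis using fst snd by (simp add: satisfies_def prod_eq_iff)
qed

text \<open>All occurring variables get second component zero, and such pairs form a
  subalgebra.\<close>

lemma dpart_eq_0:
  assumes "\<And>t. t \<in> Poly_Mapping.keys P \<Longrightarrow> p \<notin># vars_mset t"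
  shows "dpart p P = 0"
  unfolding dpart_def dend_eval_conv eval_def snd_sum snd_prod_scale
  by (intro sum.neutral ballI, subst snd_mono_val_sq[OF bilinear_free_mul bilinear_free_mul])
    (use assms in auto)

section \<open>Dendriform relations as identities of the square\<close>

lemma dend_rels_multilinear:
  "multilinear P \<Longrightarrow> dend_rels P = {dpart p P |n p. nlinear n P \<and> p < n}"
  by (simp add: dend_rels_def dpart_def)

lemma nlinear_count_le_1: "nlinear n P \<Longrightarrow> t \<in> Poly_Mapping.keys P \<Longrightarrow> count (vars_mset t) i \<le> 1"
  by (simp add: nlinear_def count_mset_set')

lemma nlinear_not_in_vars: "nlinear n P \<Longrightarrow> t \<in> Poly_Mapping.keys P \<Longrightarrow> \<not> p < n \<Longrightarrow> p \<notin># vars_mset t"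
  by (simp add: nlinear_def)

lemma satisfies_dend_rels_iff:
  assumes "bilinear_op scale star" "bilinear_op scale circ"
  shows "(\<forall>Q\<in>dend_rels P. satisfies scale (case_dend_op star circ) Q)
    \<longleftrightarrow> satisfies (prod_scale scale) (sq star circ) P"
proof (cases "multilinear P")
  case True
  then obtain n where n: "nlinear n P" by (auto simp: multilinear_def)
  have m: "module scale" by (rule bilinear_op_module[OF assms(1)])
  have "satisfies scale (case_dend_op star circ) (dpart p P)"
    if "\<forall>Q\<in>dend_rels P. satisfies scale (case_dend_op star circ) Q" for p
  proof (cases "p < n")
    case False
    then have "dpart p P = 0" using nlinear_not_in_vars[OF n] by (intro dpart_eq_0) blast
    then show ?thesis by (simp add: satisfies_def eval_def)
  qed (use that n dend_rels_multilinear[OF True] in auto)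
  moreover have "satisfies scale (case_dend_op star circ) Q"
    if "satisfies (prod_scale scale) (sq star circ) P" "Q \<in> dend_rels P" for Q
  proof -
    from that(2) obtain p where "Q = dpart p P" unfolding dend_rels_multilinear[OF True] by blast
    with that(1) show ?thesis by (simp add: satisfies_def eval_dpart[OF assms])
  qed
  ultimately show ?thesis
    using satisfies_sq_if_dpart[OF assms nlinear_count_le_1[OF n]] by blast
next
  case False
  let ?e = "eval scale (case_dend_op star circ)"
  let ?g = "\<lambda>i. (gen (2 * i), gen (2 * i + 1))"
  have e: "map_prod (?e \<rho>) (?e \<rho>) (dend_eval ?g P)
      = eval (prod_scale scale) (sq star circ) (\<lambda>i. (\<rho> (2 * i), \<rho> (2 * i + 1))) P" for \<rho>
    using eval_dend_eval[OF assms, of \<rho> ?g P] by (simp add: eval_gen[OF bilinear_op_module[OF assms(1)]])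
  have "eval (prod_scale scale) (sq star circ) \<rho> P = 0"
    if "\<forall>Q\<in>dend_rels P. satisfies scale (case_dend_op star circ) Q" for \<rho>
  proof -
    \<comment> \<open>The inverse of the coding of pairs: even variables carry the first entries and
      odd variables the second ones.\<close>
    let ?\<rho> = "\<lambda>j. if even j then fst (\<rho> (j div 2)) else snd (\<rho> (j div 2))"
    have "eval (prod_scale scale) (sq star circ) \<rho> P = map_prod (?e ?\<rho>) (?e ?\<rho>) (dend_eval ?g P)"
      by (subst e) simp
    also have "\<dots> = 0"
      using that False by (auto simp: dend_rels_def satisfies_def prod_eq_iff)
    finally show ?thesis .
  qed
  moreover have "satisfies scale (case_dend_op star circ) Q"
    if "satisfies (prod_scale scale) (sq star circ) P" "Q \<in> dend_rels P" for Q
  proof -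
    have "map_prod (?e \<rho>) (?e \<rho>) (dend_eval ?g P) = 0" for \<rho>
      using that(1) unfolding e by (simp add: satisfies_def)
    then show ?thesis
      using that(2) False by (auto simp: dend_rels_def satisfies_def prod_eq_iff)
  qed
  ultimately show ?thesis unfolding satisfies_def[of "prod_scale scale"] by blast
qed

section \<open>Weight and last variable of dendriform relations\<close>

primrec last_var :: "'p mono \<Rightarrow> nat" where
  "last_var (Var i) = i"
| "last_var (Prod p s t) = last_var t"

text \<open>In the second components of both square products, the factor taken from a second
  component stands on the right, so the distinguished variable stays the rightmost leaf. Each
  bracket turns into one \<open>Circ\<close> in every summand, which preserves the weight.\<close>

lemma keys_dend_mono_val_subset:
  fixes p :: nat
  defines "v \<equiv> mono_val (sq (free_mul Star) (free_mul Circ))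
    (\<lambda>q. if q = p then (0, gen p) else (gen q, 0 :: (dend_op, 'r::comm_ring_1) rel))"
  shows "Poly_Mapping.keys (fst (v t)) \<subseteq> {u. weight Circ u = weight Br t} \<and>
    Poly_Mapping.keys (snd (v t)) \<subseteq> {u. weight Circ u = weight Br t \<and> last_var u = p}"
proof (induction t)
  case (Var i)
  show ?case by (auto simp: v_def gen_def split: if_splits)
next
  case (Prod o' s t)
  have v: "v (Prod q s t) = sq (free_mul Star) (free_mul Circ) q (v s) (v t)" for q
    by (simp add: v_def)
  note IH = Prod.IH(1)[THEN conjunct1] Prod.IH(1)[THEN conjunct2] Prod.IH(2)[THEN conjunct1] Prod.IH(2)[THEN conjunct2]
  show ?case
    by (cases o'; hypsubst; unfold v pol_op.case sq_dot_conv sq_br_conv fst_conv snd_conv;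
        intro conjI keys_add_subset keys_diff_subset; rule keys_free_mul_subset, rule IH, rule IH, force)
qed

lemma keys_dend_mono_val:
  assumes "u \<in> Poly_Mapping.keys (snd (mono_val (sq (free_mul Star) (free_mul Circ))
    (\<lambda>q. if q = p then (0, gen p) else (gen q, 0 :: (dend_op, 'r::comm_ring_1) rel)) t))"
  shows "weight Circ u = weight Br t \<and> last_var u = p"
  using assms keys_dend_mono_val_subset[of p t] by blast

lemma dpart_monom:
  "dpart p (monom t) = snd (mono_val (sq (free_mul Star) (free_mul Circ))
    (\<lambda>q. if q = p then (0, gen p) else (gen q, 0)) t)"
  by (simp add: dpart_def dend_eval_conv eval_monom[OF module_prod_scale[OF module_free_scale]])

text \<open>Both sides are linear, so it is enough to compare them on monomials, whose images are
  homogeneous of the same weight.\<close>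

lemma weight_part_dpart: "weight_part Circ m (dpart p P) = dpart p (weight_part Br m P)"
proof -
  have "weight_part Circ m (dpart p (monom t)) = dpart p (weight_part Br m (monom t))" for t
    unfolding weight_part_monom unfolding weight_part_eq_restr
    using keys_dend_mono_val[of _ p t]
    by (auto simp: dpart_zero dpart_monom intro!: restr_eq_self restr_eq_0)
  moreover have "module_hom free_scale free_scale (\<lambda>P. weight_part Circ m (dpart p P))"
    "module_hom free_scale free_scale (\<lambda>P. dpart p (weight_part Br m P))"
    using module_hom_compose[OF module_hom_dpart module_hom_restr]
      module_hom_compose[OF module_hom_restr module_hom_dpart]
    unfolding weight_part_eq_restr o_def by blast+
  ultimately show ?thesis using module_hom_eq_on_monoms by blast
qed

lemma last_var_dpart:
  assumes "u \<in> Poly_Mapping.keys (dpart p P)"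
  shows "last_var u = p"
proof -
  let ?r = "\<lambda>P. restr (\<lambda>t. last_var t = p) (dpart p P)"
  have "?r (monom t) = dpart p (monom t)" for t
    by (intro restr_eq_self) (auto simp: dpart_monom dest: keys_dend_mono_val)
  moreover have "module_hom free_scale free_scale ?r"
    using module_hom_compose[OF module_hom_dpart module_hom_restr] unfolding o_def .
  ultimately have "?r P = dpart p P" using module_hom_eq_on_monoms module_hom_dpart by blast
  with assms have "u \<in> Poly_Mapping.keys (?r P)" by simp
  then show ?thesis by (simp add: keys_restr)
qed

text \<open>The square of the free algebra is polarized, so commutativity and anticommutativity
  already hold there.\<close>

lemma dpart_pol_ideal:
  assumes "P \<in> pol_ideal"
  shows "dpart p P = 0"
proof -
  have "polarized (prod_scale free_scale) (sq (free_mul Star) (free_mul Circ) Dot)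
      (sq (free_mul Star) (free_mul Circ) Br)"
    by (simp add: polarized_sq bilinear_free_mul)
  from eval_pol_ideal[OF this assms] show ?thesis
    by (simp add: dpart_def dend_eval_conv)
qed

section \<open>Recovering a polarized relation from its dendriform part\<close>

lemma pol_ideal_minus: "P \<in> pol_ideal \<Longrightarrow> - P \<in> pol_ideal"
  using pol_ideal.scale[of P "- 1"] by simp

lemma pol_ideal_diff: "P \<in> pol_ideal \<Longrightarrow> Q \<in> pol_ideal \<Longrightarrow> P - Q \<in> pol_ideal"
  using pol_ideal.add[OF _ pol_ideal_minus] by (metis add_uminus_conv_diff)

lemma pol_ideal_sum: "(\<And>i. i \<in> I \<Longrightarrow> f i \<in> pol_ideal) \<Longrightarrow> sum f I \<in> pol_ideal"
  by (induction I rule: infinite_finite_induct) (auto intro: pol_ideal.zero pol_ideal.add)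

lemma pol_ideal_free_mul_cong:
  assumes "P - P' \<in> pol_ideal" "Q - Q' \<in> pol_ideal"
  shows "free_mul o' P Q - free_mul o' P' Q' \<in> pol_ideal"
proof -
  have "free_mul o' (P - P') Q + free_mul o' P' (Q - Q') \<in> pol_ideal"
    using assms by (intro pol_ideal.intros)
  then show ?thesis by (simp add: bilinear_op_simps[OF bilinear_free_mul])
qed

text \<open>
  A square of the free polarized algebra, with products such that \<open>a * b + b * a = a \<cdot> b\<close> modulo
  commutativity holds in the first component for \<open>h = 1/2\<close>. On a monomial whose last variable
  is the distinguished one, the second component undoes \<^const>\<open>dpart\<close>.
\<close>

definition unpol_op :: "'r::comm_ring_1 \<Rightarrow> dend_op
    \<Rightarrow> (pol_op, 'r) rel \<times> (pol_op, 'r) rel \<Rightarrow> (pol_op, 'r) rel \<times> (pol_op, 'r) rel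
    \<Rightarrow> (pol_op, 'r) rel \<times> (pol_op, 'r) rel"
  where "unpol_op h q u v = (free_scale h (free_mul (case_dend_op Dot Br q) (fst u) (fst v)),
    free_mul (case_dend_op Dot Br q) (fst u) (snd v))"

text \<open>In the second component of a monomial, the rightmost leaf contributes its second entry
  and all other leaves their first entries. Generators go to diagonal pairs because a variable may
  occur in either role.\<close>

definition unpol :: "'r::comm_ring_1 \<Rightarrow> (dend_op, 'r) rel \<Rightarrow> (pol_op, 'r) rel \<times> (pol_op, 'r) rel"
  where "unpol h = eval (prod_scale free_scale) (unpol_op h) (\<lambda>i. (gen i, gen i))"

lemma bilinear_unpol_op: "bilinear_op (prod_scale free_scale) (unpol_op h q)"
  by (rule bilinear_opI[OF module_prod_scale[OF module_free_scale]])
    (simp_all add: unpol_op_def prod_eq_iff bilinear_op_simps[OF bilinear_free_mul]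
      free.scale_right_distrib mult.commute)

lemma module_hom_unpol: "module_hom free_scale (prod_scale free_scale) (unpol h)"
  unfolding unpol_def by (intro module_hom_eval module_prod_scale module_free_scale)

lemma unpol_free_mul: "unpol h (free_mul q P Q) = unpol_op h q (unpol h P) (unpol h Q)"
  unfolding unpol_def by (rule eval_free_mul[of _ "unpol_op h", OF bilinear_unpol_op])

lemmas unpol_simps = unpol_free_mul module_hom.add[OF module_hom_unpol] module_hom.diff[OF module_hom_unpol]
  module_hom.neg[OF module_hom_unpol] module_hom.zero[OF module_hom_unpol]

lemma unpol_gen: "unpol h (gen i) = (gen i, gen i)"
  by (simp add: unpol_def eval_gen module_prod_scale module_free_scale)

text \<open>Both claims need a simultaneous induction: at a product, the second component combines
  the second component of the factor containing \<open>p\<close> with the first component of the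
  other factor.\<close>

lemma unpol_dend_mono_val:
  fixes h :: "'r::comm_ring_1" and p :: nat
  assumes h: "h + h = 1"
  defines "v \<equiv> mono_val (sq (free_mul Star) (free_mul Circ))
    (\<lambda>q. if q = p then (0, gen p) else (gen q, 0 :: (dend_op, 'r) rel))"
  shows "(p \<notin># vars_mset t \<longrightarrow> fst (unpol h (fst (v t))) - monom t \<in> pol_ideal) \<and>
    (count (vars_mset t) p = 1 \<longrightarrow> snd (unpol h (snd (v t))) - monom t \<in> pol_ideal)"
proof (induction t)
  case (Var i)
  show ?case by (simp add: v_def unpol_gen) (simp add: gen_def pol_ideal.zero)
next
  case (Prod q s t)
  have v: "v (Prod q s t) = sq (free_mul Star) (free_mul Circ) q (v s) (v t)" for q
    by (simp add: v_def)
  have monom: "monom (Prod q s t) = (free_mul q (monom s) (monom t) :: (pol_op, 'r) rel)" for q s t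
    by (simp flip: mono_val_free_mul)
  note simps = v monom sq_dot_conv sq_br_conv unpol_simps unpol_op_def fst_diff snd_diff fst_uminus snd_uminus
    bilinear_op_simps[OF bilinear_free_mul]
  have snd0: "snd (v r) = 0" if "p \<notin># vars_mset r" for r
    unfolding v_def by (rule snd_mono_val_sq[OF bilinear_free_mul bilinear_free_mul]) (use that in auto)
  have half: "free_scale h P + free_scale h P = P" for P :: "(pol_op, 'r) rel"
    using free.scale_left_distrib[of h h P] h by simp
  have 1: "fst (unpol h (fst (v (Prod q s t)))) - monom (Prod q s t) \<in> pol_ideal"
    if "p \<notin># vars_mset (Prod q s t)"
  proof -
    define a b where "a = fst (unpol h (fst (v s)))" and "b = fst (unpol h (fst (v t)))"
    have ab: "free_mul q a b - free_mul q (monom s) (monom t) \<in> pol_ideal"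
      using that Prod.IH by (intro pol_ideal_free_mul_cong) (auto simp: a_def b_def)
    show ?thesis
    proof (cases q)
      case Dot
      \<comment> \<open>Subtracting \<open>h\<close> times the commutator of \<open>a\<close> and
        \<open>b\<close> turns their product into the average of both orders, which is what
        \<open>sq_dot\<close> produces.\<close>
      have "(free_mul Dot a b - free_mul Dot (monom s) (monom t))
          - free_scale h (free_mul Dot a b - free_mul Dot b a) \<in> pol_ideal"
        by (rule pol_ideal_diff[OF ab[unfolded Dot] pol_ideal.scale[OF pol_ideal.comm]])
      also have "(free_mul Dot a b - free_mul Dot (monom s) (monom t))
          - free_scale h (free_mul Dot a b - free_mul Dot b a)
        = free_scale h (free_mul Dot a b) + free_scale h (free_mul Dot b a) - free_mul Dot (monom s) (monom t)"
        by (subst (1) half[of "free_mul Dot a b", symmetric]) (simp add: free.scale_right_diff_distrib)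
      finally show ?thesis
        by (simp add: Dot simps free.scale_right_diff_distrib algebra_simps flip: a_def b_def)
    next
      case Br
      \<comment> \<open>As for \<open>Dot\<close>, but with the anticommutator, since
        \<open>sq_br\<close> produces half the difference of both orders.\<close>
      have "(free_mul Br a b - free_mul Br (monom s) (monom t))
          - free_scale h (free_mul Br a b + free_mul Br b a) \<in> pol_ideal"
        by (rule pol_ideal_diff[OF ab[unfolded Br] pol_ideal.scale[OF pol_ideal.anticomm]])
      also have "(free_mul Br a b - free_mul Br (monom s) (monom t))
          - free_scale h (free_mul Br a b + free_mul Br b a)
        = free_scale h (free_mul Br a b) - free_scale h (free_mul Br b a) - free_mul Br (monom s) (monom t)"
        by (subst (1) half[of "free_mul Br a b", symmetric]) (simp add: free.scale_right_distrib)
      finally show ?thesis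
        by (simp add: Br simps free.scale_right_distrib algebra_simps flip: a_def b_def)
    qed
  qed
  have 2: "snd (unpol h (snd (v (Prod q s t)))) - monom (Prod q s t) \<in> pol_ideal"
    if count: "count (vars_mset (Prod q s t)) p = 1"
  proof (cases "p \<in># vars_mset s")
    case False
    then have "count (vars_mset t) p = 1" using count by (simp add: not_in_iff)
    with False Prod.IH have "free_mul q (fst (unpol h (fst (v s)))) (snd (unpol h (snd (v t))))
        - free_mul q (monom s) (monom t) \<in> pol_ideal"
      by (intro pol_ideal_free_mul_cong) auto
    then show ?thesis by (cases q) (simp_all add: simps snd0[OF False])
  next
    case True
    then have "count (vars_mset s) p > 0" by simp
    with count have "count (vars_mset t) p = 0" and s: "count (vars_mset s) p = 1"
      unfolding vars_mset.simps count_union by linarith+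
    then have t: "p \<notin># vars_mset t" by (simp add: not_in_iff)
    define y b where "y = snd (unpol h (snd (v s)))" and "b = fst (unpol h (fst (v t)))"
    \<comment> \<open>When \<open>p\<close> lies in \<open>s\<close>, only the summand with
      exchanged factors survives, carrying a minus sign for \<open>Br\<close>. Adding an element of
      the ideal restores the order.\<close>
    have yb: "free_mul q b y - free_mul q (monom t) (monom s) \<in> pol_ideal"
      using s t Prod.IH by (intro pol_ideal_free_mul_cong) (auto simp: y_def b_def)
    show ?thesis
    proof (cases q)
      case Dot
      have "(free_mul Dot b y - free_mul Dot (monom t) (monom s))
          + (free_mul Dot (monom t) (monom s) - free_mul Dot (monom s) (monom t)) \<in> pol_ideal"
        by (rule pol_ideal.add[OF yb[unfolded Dot] pol_ideal.comm])
      then show ?thesis by (simp add: Dot simps snd0[OF t] flip: y_def b_def)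
    next
      case Br
      have "- (free_mul Br b y - free_mul Br (monom t) (monom s))
          - (free_mul Br (monom t) (monom s) + free_mul Br (monom s) (monom t)) \<in> pol_ideal"
        by (rule pol_ideal_diff[OF pol_ideal_minus[OF yb[unfolded Br]] pol_ideal.anticomm])
      then show ?thesis by (simp add: Br simps snd0[OF t] algebra_simps flip: y_def b_def)
    qed
  qed
  from 1 2 show ?case by blast
qed

lemma unpol_dpart:
  assumes "h + h = 1" "\<And>t. t \<in> Poly_Mapping.keys P \<Longrightarrow> count (vars_mset t) p = 1"
  shows "snd (unpol h (dpart p P)) - P \<in> pol_ideal"
proof -
  note hom = module_hom_compose[OF module_hom_compose[OF module_hom_dpart module_hom_unpol]
      module_hom_snd[OF module_free_scale], unfolded o_def]
  have 1: "snd (unpol h (dpart p P)) = (\<Sum>t\<in>Poly_Mapping.keys P.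
      free_scale (Poly_Mapping.lookup P t) (snd (unpol h (dpart p (monom t)))))"
    by (subst sum_monom[of P]) (simp add: module_hom.sum[OF hom] module_hom.scale[OF hom])
  have "snd (unpol h (dpart p P)) - P = (\<Sum>t\<in>Poly_Mapping.keys P.
      free_scale (Poly_Mapping.lookup P t) (snd (unpol h (dpart p (monom t))) - monom t))"
    unfolding 1 by (simp add: sum_subtractf free.scale_right_diff_distrib flip: sum_monom)
  also have "\<dots> \<in> pol_ideal"
    using unpol_dend_mono_val[OF assms(1)] assms(2)
    by (intro pol_ideal_sum pol_ideal.scale) (simp add: dpart_monom)
  finally show ?thesis .
qed

text \<open>\<open>dpart p\<close> is injective modulo the ideal on such relations, because
  \<open>unpol\<close> with \<open>h\<close> an inverse of 2 is a left inverse there.\<close>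

lemma pol_ideal_if_dpart_eq_0:
  assumes "(2::'r::comm_ring_1) dvd 1" "dpart p (P :: (pol_op, 'r) rel) = 0"
    and "\<And>t. t \<in> Poly_Mapping.keys P \<Longrightarrow> count (vars_mset t) p = 1"
  shows "P \<in> pol_ideal"
proof -
  from assms(1) obtain h :: 'r where "h + h = 1" by (metis dvdE mult_2)
  from unpol_dpart[OF this, of P p] assms(2,3) have "- P \<in> pol_ideal" by (simp add: unpol_simps)
  then show ?thesis using pol_ideal_minus by fastforce
qed

section \<open>Multilinear relations\<close>

lemma rename_hom: "module_hom free_scale free_scale (rename \<sigma>)"
  unfolding rename_def[abs_def] by (intro module_hom_eval module_free_scale)

lemma free_subspace_vimage:
  assumes "module_hom free_scale s f" "module.subspace s N"
  shows "free.subspace {P. f P \<in> N}"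
  using assms module_hom.subspace_vimage[OF assms] by (simp add: vimage_def)

lemma subspace_keys:
  fixes \<Phi> :: "'p mono \<Rightarrow> bool"
  shows "free.subspace {X :: ('p, 'r::comm_ring_1) rel. \<forall>t\<in>Poly_Mapping.keys X. \<Phi> t}"
proof (rule free.subspaceI)
  fix X Y :: "('p, 'r) rel" and c
  assume X: "X \<in> {X. \<forall>t\<in>Poly_Mapping.keys X. \<Phi> t}"
  show "free_scale c X \<in> {X. \<forall>t\<in>Poly_Mapping.keys X. \<Phi> t}"
    using X by (force simp: in_keys_iff)
  assume "Y \<in> {X. \<forall>t\<in>Poly_Mapping.keys X. \<Phi> t}"
  with X show "X + Y \<in> {X. \<forall>t\<in>Poly_Mapping.keys X. \<Phi> t}"
    using Poly_Mapping.keys_add[of X Y] by blast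
qed simp

text \<open>The induction principle for the span: a linear condition need only be checked on the
  renamed generators.\<close>

lemma pol_relations_mem_subspace:
  assumes "X \<in> pol_relations Rs" "free.subspace N"
    and "\<And>\<sigma> P. bij \<sigma> \<Longrightarrow> P \<in> Rs \<Longrightarrow> rename \<sigma> (pol_rel P) \<in> N"
  shows "X \<in> N"
proof -
  have "{rename \<sigma> P |\<sigma> P. bij \<sigma> \<and> P \<in> pol_rel ` Rs} \<subseteq> N" using assms(3) by auto
  from free.span_minimal[OF this assms(2)] assms(1) show ?thesis
    by (auto simp: pol_relations_def rel_space_def)
qed

section \<open>Correspondence between polarized and dendriform relations\<close>

context
  fixes Rs :: "(unit, 'r::comm_ring_1) rel set"
  assumes multilinear: "\<forall>P\<in>Rs. multilinear P"
begin

lemma obtain_nlinear: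
  assumes "P \<in> Rs"
  obtains n where "nlinear n (pol_rel P)"
  using multilinear assms nlinear_pol_rel unfolding multilinear_def by blast

lemma dend_rels_pol_rel:
  assumes "P \<in> Rs"
  shows "dend_rels (pol_rel P) = {dpart p (pol_rel P) |n p. nlinear n (pol_rel P) \<and> p < n}"
  using obtain_nlinear[OF assms] by (intro dend_rels_multilinear) (auto simp: multilinear_def)

text \<open>By linearity only renamed generators matter. Surjectivity of \<sigma> gives
  \<open>q\<close> with \<open>p = \<sigma> q\<close>, and then the relation is a renaming of
  \<open>dpart q\<close>, which is either a dendriform generator or zero.\<close>

lemma dpart_mem_dend_relations:
  assumes "X \<in> pol_relations Rs"
  shows "dpart p X \<in> dend_relations Rs"
proof -
  have sub: "free.subspace (dend_relations Rs)"
    by (simp add: dend_relations_def rel_space_def free.subspace_span)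
  have "X \<in> {X. dpart p X \<in> dend_relations Rs}"
    using assms
  proof (rule pol_relations_mem_subspace)
    show "free.subspace {X. dpart p X \<in> dend_relations Rs}"
      by (rule free_subspace_vimage[OF module_hom_dpart sub])
  next
    fix \<sigma> :: "nat \<Rightarrow> nat" and P assume \<sigma>: "bij \<sigma>" and P: "P \<in> Rs"
    obtain n where n: "nlinear n (pol_rel P)" using obtain_nlinear[OF P] .
    obtain q where q: "p = \<sigma> q" using \<sigma> by (metis bij_pointE)
    have eq: "dpart p (rename \<sigma> (pol_rel P)) = rename \<sigma> (dpart q (pol_rel P))"
      unfolding q by (rule dpart_rename[OF bij_is_inj[OF \<sigma>]])
    show "rename \<sigma> (pol_rel P) \<in> {X. dpart p X \<in> dend_relations Rs}"
    proof (cases "q < n")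
      case True
      then have "dpart q (pol_rel P) \<in> (\<Union>P\<in>Rs. dend_rels (pol_rel P))"
        using n P dend_rels_pol_rel by blast
      then show ?thesis
        unfolding mem_Collect_eq eq dend_relations_def rel_space_def
        using \<sigma> by (intro free.span_base) blast
    next
      case False
      then have "dpart q (pol_rel P) = 0" using nlinear_not_in_vars[OF n] by (intro dpart_eq_0) blast
      then show ?thesis
        by (simp add: eq module_hom.zero[OF rename_hom] free.subspace_0[OF sub])
    qed
  qed
  then show ?thesis by simp
qed

lemma count_pol_relations_le_1:
  assumes "X \<in> pol_relations Rs" "t \<in> Poly_Mapping.keys X"
  shows "count (vars_mset t) i \<le> 1"
proof -
  let ?N = "{X :: (pol_op, 'r) rel. \<forall>t\<in>Poly_Mapping.keys X. \<forall>i. count (vars_mset t) i \<le> 1}"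
  have "X \<in> ?N"
    using assms(1)
  proof (rule pol_relations_mem_subspace)
    show "free.subspace ?N"
      by (rule subspace_keys)
  next
    fix \<sigma> :: "nat \<Rightarrow> nat" and P assume \<sigma>: "bij \<sigma>" and P: "P \<in> Rs"
    obtain n where n: "nlinear n (pol_rel P)" using obtain_nlinear[OF P] .
    show "rename \<sigma> (pol_rel P) \<in> ?N"
      using vars_mset_rename[OF n, of _ \<sigma>] inj_on_subset[OF bij_is_inj[OF \<sigma>]]
      by (auto simp: image_mset_mset_set count_mset_set')
  qed
  with assms(2) show ?thesis by blast
qed

text \<open>Renaming \<open>dpart q\<close> of a generator by \<sigma> gives a relation whose
  monomials all end in \<open>\<sigma> q\<close>. Selecting the last variable \<open>p\<close> thus
  keeps the generators with \<open>\<sigma> q = p\<close> and kills the others, and the kept ones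
  combine to \<open>dpart p\<close> of one polarized relation. The condition on \<open>count\<close>
  allows that relation to be recovered from its \<open>dpart p\<close>.\<close>

lemma dend_relations_last_var:
  assumes "Q \<in> dend_relations Rs"
  obtains X where "X \<in> pol_relations Rs" "\<And>t. t \<in> Poly_Mapping.keys X \<Longrightarrow> count (vars_mset t) p = 1"
    "restr (\<lambda>t. last_var t = p) Q = dpart p X"
proof -
  define N where "N = {X \<in> pol_relations Rs. \<forall>t\<in>Poly_Mapping.keys X. count (vars_mset t) p = 1}"
  have N: "free.subspace N"
  proof -
    have "free.subspace {X :: (pol_op, 'r) rel. \<forall>t\<in>Poly_Mapping.keys X. count (vars_mset t) p = 1}"
      by (rule subspace_keys)
    moreover have "free.subspace (pol_relations Rs)"
      by (simp add: pol_relations_def rel_space_def free.subspace_span)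
    ultimately show ?thesis
      unfolding N_def using free.subspace_inter by (simp add: Collect_conj_eq)
  qed
  have im: "free.subspace (dpart p ` N)"
    by (rule module_hom.subspace_image[OF module_hom_dpart N])
  have sub: "free.subspace {Q. restr (\<lambda>t. last_var t = p) Q \<in> dpart p ` N}"
    by (rule free_subspace_vimage[OF module_hom_restr im])
  have "{rename \<sigma> P |\<sigma> P. bij \<sigma> \<and> P \<in> (\<Union>P\<in>Rs. dend_rels (pol_rel P))}
      \<subseteq> {Q. restr (\<lambda>t. last_var t = p) Q \<in> dpart p ` N}"
  proof clarify
    fix \<sigma> :: "nat \<Rightarrow> nat" and P Q assume \<sigma>: "bij \<sigma>" and P: "P \<in> Rs" and "Q \<in> dend_rels (pol_rel P)"
    then obtain n q where n: "nlinear n (pol_rel P)" and q: "q < n" and Q: "Q = dpart q (pol_rel P)"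
      by (auto simp: dend_rels_pol_rel)
    have eq: "rename \<sigma> Q = dpart (\<sigma> q) (rename \<sigma> (pol_rel P))"
      by (simp add: Q dpart_rename[OF bij_is_inj[OF \<sigma>]])
    show "restr (\<lambda>t. last_var t = p) (rename \<sigma> Q) \<in> dpart p ` N"
    proof (cases "\<sigma> q = p")
      case True
      have "restr (\<lambda>t. last_var t = p) (rename \<sigma> Q) = dpart p (rename \<sigma> (pol_rel P))"
        unfolding eq True by (intro restr_eq_self last_var_dpart)
      moreover have "rename \<sigma> (pol_rel P) \<in> pol_relations Rs"
        unfolding pol_relations_def rel_space_def using P \<sigma> by (intro free.span_base) blast
      moreover have "count (vars_mset t) p = 1" if "t \<in> Poly_Mapping.keys (rename \<sigma> (pol_rel P))" for t
        using vars_mset_rename[OF n that] inj_on_subset[OF bij_is_inj[OF \<sigma>]] q True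
        by (auto simp: image_mset_mset_set count_mset_set')
      ultimately show ?thesis by (auto simp: N_def)
    next
      case False
      then have "restr (\<lambda>t. last_var t = p) (rename \<sigma> Q) = 0"
        unfolding eq by (intro restr_eq_0) (auto dest: last_var_dpart)
      then show ?thesis using free.subspace_0[OF im] by simp
    qed
  qed
  from free.span_minimal[OF this sub] assms have "restr (\<lambda>t. last_var t = p) Q \<in> dpart p ` N"
    by (auto simp: dend_relations_def rel_space_def)
  then show ?thesis using that by (auto simp: N_def)
qed

end

section \<open>Lowest weight parts\<close>

lemma weight_part_zero [simp]: "weight_part w m 0 = 0"
  by (simp add: weight_part_def)

text \<open>The weight parts add up to \<open>P\<close>, so they cannot all lie in the submodule
  \<open>N\<close>, and a least weight outside \<open>N\<close> exists.\<close>

lemma lowest_partE: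
  fixes P :: "('p, 'r::comm_ring_1) rel"
  assumes "free.subspace N" "P \<notin> N"
  obtains m where "lowest_part w N P = weight_part w m P" "weight_part w m P \<notin> N"
    "\<And>k. k < m \<Longrightarrow> weight_part w k P \<in> N"
proof -
  have ex: "\<exists>m. weight_part w m P \<notin> N"
  proof (rule ccontr)
    assume "\<nexists>m. weight_part w m P \<notin> N"
    then have "(\<Sum>k\<in>weight w ` Poly_Mapping.keys P. weight_part w k P) \<in> N"
      by (intro free.subspace_sum assms(1)) auto
    with assms(2) show False by (simp add: weight_part_eq_restr sum_restr_fibres)
  qed
  show ?thesis
  proof (rule that)
    show "lowest_part w N P = weight_part w (LEAST m. weight_part w m P \<notin> N) P"
      using assms(2) by (simp add: lowest_part_def)
    show "weight_part w (LEAST m. weight_part w m P \<notin> N) P \<notin> N"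
      using ex by (rule LeastI_ex)
  next
    fix k assume "k < (LEAST m. weight_part w m P \<notin> N)"
    then show "weight_part w k P \<in> N" using not_less_Least by blast
  qed
qed

lemma subspace_pol_ideal: "free.subspace pol_ideal"
  by (rule free.subspaceI) (auto intro: pol_ideal.intros)

text \<open>The lowest weight part of \<open>P\<close> is taken modulo the ideal, that of a
  dendriform relation modulo zero. They match because \<open>dpart p\<close> preserves weight and
  kills the ideal, and is injective modulo the ideal on the relations containing \<open>p\<close>
  exactly once in each monomial.\<close>

lemma ul_dend_cat_eq_pol_dend:
  assumes two: "(2::'r::comm_ring_1) dvd 1"
    and multilinear: "\<forall>P\<in>(Rs :: (unit, 'r) rel set). multilinear P"
  shows "ul_dend_cat Rs scale star circ \<longleftrightarrow> pol_dend (ul_pol_cat Rs) scale star circ"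
proof (cases "bilinear_op scale star \<and> bilinear_op scale circ")
  case False
  then show ?thesis by (auto simp: ul_dend_cat_def pol_dend_def)
next
  case True
  then have star: "bilinear_op scale star" and circ: "bilinear_op scale circ" by auto
  note m = bilinear_op_module[OF star]
  have "(\<forall>Q\<in>dend_relations Rs. satisfies scale (case_dend_op star circ) (lowest_part Circ {0} Q))
    \<longleftrightarrow> (\<forall>P\<in>pol_relations Rs. satisfies (prod_scale scale) (sq star circ) (lowest_part Br pol_ideal P))"
  proof (intro iffI ballI)
    fix P assume *: "\<forall>Q\<in>dend_relations Rs. satisfies scale (case_dend_op star circ) (lowest_part Circ {0} Q)"
      and P: "P \<in> pol_relations Rs"
    show "satisfies (prod_scale scale) (sq star circ) (lowest_part Br pol_ideal P)"
    proof (cases "P \<in> pol_ideal")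
      case True
      then show ?thesis by (simp add: lowest_part_def satisfies_def eval_def)
    next
      case False
      with subspace_pol_ideal obtain k where low: "lowest_part Br pol_ideal P = weight_part Br k P"
        and less: "\<And>j. j < k \<Longrightarrow> weight_part Br j P \<in> pol_ideal"
        by (rule lowest_partE) blast
      have "satisfies scale (case_dend_op star circ) (dpart p (weight_part Br k P))" for p
      proof (cases "dpart p (weight_part Br k P) = 0")
        case True
        then show ?thesis by (simp add: satisfies_def eval_def)
      next
        case nz: False
        then have "dpart p P \<notin> {0}" by (auto simp flip: weight_part_dpart)
        then obtain l where l: "lowest_part Circ {0} (dpart p P) = weight_part Circ l (dpart p P)"
          "weight_part Circ l (dpart p P) \<notin> {0}" "\<And>j. j < l \<Longrightarrow> weight_part Circ j (dpart p P) \<in> {0}"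
          by (rule lowest_partE[OF free.subspace_single_0]) blast
        \<comment> \<open>Below \<open>k\<close> the parts of \<open>P\<close> lie in the ideal and
          are killed by \<open>dpart p\<close>, while the part of weight \<open>k\<close> has a
          nonzero image by assumption.\<close>
        have "l = k"
          using l(2) l(3)[of k] nz less[of l] dpart_pol_ideal
          by (cases l k rule: linorder_cases) (auto simp: weight_part_dpart)
        with l(1) bspec[OF * dpart_mem_dend_relations[OF multilinear P, of p]] show ?thesis
          by (simp add: weight_part_dpart)
      qed
      moreover have "count (vars_mset t) i \<le> 1" if "t \<in> Poly_Mapping.keys (weight_part Br k P)" for t i
        using that count_pol_relations_le_1[OF multilinear P] by (simp add: weight_part_eq_restr keys_restr)
      ultimately show ?thesis
        unfolding low by (intro satisfies_sq_if_dpart[OF star circ])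
    qed
  next
    fix Q assume *: "\<forall>P\<in>pol_relations Rs. satisfies (prod_scale scale) (sq star circ) (lowest_part Br pol_ideal P)"
      and Q: "Q \<in> dend_relations Rs"
    show "satisfies scale (case_dend_op star circ) (lowest_part Circ {0} Q)"
    proof (cases "Q = 0")
      case True
      then show ?thesis by (simp add: lowest_part_def satisfies_def eval_def)
    next
      case False
      then have "Q \<notin> {0}" by simp
      then obtain k where low: "lowest_part Circ {0} Q = weight_part Circ k Q"
        and less: "\<And>j. j < k \<Longrightarrow> weight_part Circ j Q = 0"
        by (rule lowest_partE[OF free.subspace_single_0]) blast
      have sat: "satisfies scale (case_dend_op star circ) (restr (\<lambda>t. last_var t = p) (weight_part Circ k Q))" for p
      proof -
        from dend_relations_last_var[OF multilinear Q] obtain X where X: "X \<in> pol_relations Rs"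
          and count: "\<And>t. t \<in> Poly_Mapping.keys X \<Longrightarrow> count (vars_mset t) p = 1"
          and Q_X: "restr (\<lambda>t. last_var t = p) Q = dpart p X"
          by blast
        have w: "restr (\<lambda>t. last_var t = p) (weight_part Circ j Q) = dpart p (weight_part Br j X)" for j
        proof -
          have "restr (\<lambda>t. last_var t = p) (weight_part Circ j Q)
              = weight_part Circ j (restr (\<lambda>t. last_var t = p) Q)"
            unfolding weight_part_eq_restr by (rule restr_commute)
          then show ?thesis by (simp add: Q_X weight_part_dpart)
        qed
        \<comment> \<open>The only use of the invertibility of 2: vanishing of
          \<open>dpart p\<close> in weight \<open>j\<close> forces the part of \<open>X\<close> to
          vanish modulo the ideal, so no lower part of \<open>X\<close> precedes weight
          \<open>k\<close>.\<close>
        have X_less: "weight_part Br j X \<in> pol_ideal" if "j < k" for j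
        proof (rule pol_ideal_if_dpart_eq_0[OF two, where p = p])
          show "dpart p (weight_part Br j X) = 0"
            unfolding w[symmetric] less[OF that] by (simp add: restr_def)
        qed (use count in \<open>auto simp: weight_part_eq_restr keys_restr\<close>)
        show ?thesis
        proof (cases "dpart p (weight_part Br k X) = 0")
          case True
          then show ?thesis by (simp add: w satisfies_def eval_def)
        next
          case nz: False
          have "X \<notin> pol_ideal"
          proof
            assume "X \<in> pol_ideal"
            then have "weight_part Circ k (dpart p X) = 0" by (simp add: dpart_pol_ideal)
            with nz show False by (simp add: weight_part_dpart)
          qed
          with subspace_pol_ideal obtain l where l: "lowest_part Br pol_ideal X = weight_part Br l X"
            "weight_part Br l X \<notin> pol_ideal" "\<And>j. j < l \<Longrightarrow> weight_part Br j X \<in> pol_ideal"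
            by (rule lowest_partE) blast
          have "l = k"
            using l(2) l(3)[of k] nz X_less[of l] dpart_pol_ideal
            by (cases l k rule: linorder_cases) auto
          with l(1) bspec[OF * X] show ?thesis
            by (simp add: w satisfies_def eval_dpart[OF star circ])
        qed
      qed
      \<comment> \<open>The pieces with different last variables add up to the lowest part of
        \<open>Q\<close>, so their separate vanishing suffices.\<close>
      have "eval scale (case_dend_op star circ) \<rho> (weight_part Circ k Q) = 0" for \<rho>
        using sat by (subst sum_restr_fibres[where f = last_var, symmetric])
          (simp add: module_hom.sum[OF module_hom_eval[OF m]] satisfies_def)
      then show ?thesis by (simp add: low satisfies_def)
    qed
  qed
  then show ?thesis
    using True polarized_sq[OF star circ] by (simp add: ul_dend_cat_def pol_dend_def ul_pol_cat_def)
qed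

section \<open>Weight generated relations\<close>

text \<open>A homogeneous generator is its own lowest part and hence holds by assumption; identities
  pass to spans.\<close>

lemma satisfies_dend_relations_if_weight_generated:
  assumes cat: "ul_dend_cat Rs scale star circ" and "weight_generated (dend_relations Rs)"
    and Q: "Q \<in> dend_relations Rs"
  shows "satisfies scale (case_dend_op star circ) Q"
proof -
  from assms(2) obtain H where hom: "\<And>P. P \<in> H \<Longrightarrow> \<exists>m. homogeneous Circ m P"
    and H: "dend_relations Rs = free.span H"
    unfolding weight_generated_def by blast
  have m: "module scale" using cat bilinear_op_module by (auto simp: ul_dend_cat_def)
  have "satisfies scale (case_dend_op star circ) P" if P: "P \<in> H" for P
  proof (cases "P = 0")
    case True
    then show ?thesis by (simp add: satisfies_def eval_def)
  next
    case False
    then have "P \<notin> {0}" by simp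
    then obtain k where k: "lowest_part Circ {0} P = weight_part Circ k P" "weight_part Circ k P \<notin> {0}"
      by (rule lowest_partE[OF free.subspace_single_0]) blast
    obtain l where l: "homogeneous Circ l P" using hom[OF P] by blast
    have "l = k"
      using k(2) l restr_eq_0[of P "\<lambda>t. weight Circ t = k"]
      by (auto simp: weight_part_eq_restr homogeneous_def)
    then have "lowest_part Circ {0} P = P"
      unfolding k(1) weight_part_eq_restr using l by (intro restr_eq_self) (simp add: homogeneous_def)
    moreover have "P \<in> dend_relations Rs" unfolding H using P by (rule free.span_base)
    ultimately show ?thesis using cat by (auto simp: ul_dend_cat_def)
  qed
  then show ?thesis using satisfies_span[OF m _ Q[unfolded H]] by blast
qed

text \<open>The dendriform generators express that \<open>pol_rel P\<close> holds in the square, and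
  evaluating \<open>pol_rel P\<close> there is evaluating \<open>P\<close> for the sum of the two
  products.\<close>

lemma pol_dend_pol_cat_if_dend_relations:
  assumes star: "bilinear_op scale star" and circ: "bilinear_op scale circ"
    and sat: "\<And>Q. Q \<in> dend_relations Rs \<Longrightarrow> satisfies scale (case_dend_op star circ) Q"
  shows "pol_dend (pol_cat Rs) scale star circ"
proof -
  note m = bilinear_op_module[OF star]
  note b = bilinear_sq[OF star circ, of Dot, simplified] bilinear_sq[OF star circ, of Br, simplified]
  have "satisfies (prod_scale scale) (\<lambda>_ a b. sq_dot star a b + sq_br circ a b) P" if P: "P \<in> Rs" for P
  proof -
    have "dend_rels (pol_rel P) \<subseteq> dend_relations Rs"
      using rel_space_superset[of "\<Union>P\<in>Rs. dend_rels (pol_rel P)"] P by (auto simp: dend_relations_def)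
    then have "satisfies (prod_scale scale) (sq star circ) (pol_rel P)"
      using sat satisfies_dend_rels_iff[OF star circ] by blast
    then show ?thesis
      using eval_pol_rel[of "prod_scale scale" "sq star circ", simplified, OF b] by (simp add: satisfies_def)
  qed
  moreover have "bilinear_op (prod_scale scale) (\<lambda>a b. sq_dot star a b + sq_br circ a b)"
    by (rule bilinear_opI[OF module_prod_scale[OF m]])
      (simp_all add: bilinear_op_simps[OF b(1)] bilinear_op_simps[OF b(2)]
        module.scale_right_distrib[OF module_prod_scale[OF m]])
  ultimately show ?thesis
    using polarized_sq[OF star circ] star circ by (auto simp: pol_dend_def pol_cat_def alg_cat_def)
qed

section \<open>Formal deformations\<close>

lemma fps_nth_fps_scale:
  "fps_nth (fps_scale scale c X) n = (\<Sum>i=0..n. scale (fps_nth c i) (fps_nth X (n - i)))"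
  by (simp add: fps_scale_def)

lemma fps_nth_fps_scale_X_power:
  assumes "module scale"
  shows "fps_nth (fps_scale scale (fps_const r * fps_X ^ k) X) n = (if n < k then 0 else scale r (fps_nth X (n - k)))"
proof -
  have "fps_nth (fps_scale scale (fps_const r * fps_X ^ k) X) n
      = (\<Sum>i=0..n. if i = k then scale r (fps_nth X (n - i)) else 0)"
    unfolding fps_nth_fps_scale
    by (intro sum.cong) (auto simp: fps_X_power_nth module.scale_zero_left[OF assms])
  then show ?thesis by simp
qed

lemma fps_nth_fps_scale_const:
  "module scale \<Longrightarrow> fps_nth (fps_scale scale (fps_const r) X) n = scale r (fps_nth X n)"
  using fps_nth_fps_scale_X_power[of scale r 0 X n] by simp

text \<open>The relations have coefficients in the base ring, so the power series algebra is also
  viewed as an algebra over constants.\<close>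

lemma bilinear_op_restrict_scalars:
  fixes scale :: "'r::comm_ring_1 \<Rightarrow> 'a::ab_group_add \<Rightarrow> 'a"
  assumes "bilinear_op (fps_scale scale) mul"
  shows "bilinear_op (\<lambda>r. fps_scale scale (fps_const r)) mul"
proof -
  interpret module "fps_scale scale" by (rule bilinear_op_module[OF assms])
  show ?thesis
    by (rule bilinear_opI, unfold_locales)
      (simp_all add: bilinear_op_simps[OF assms] scale_right_distrib flip: scale_left_distrib)
qed

lemma bilinear_op_fps_nth:
  fixes scale :: "'r::comm_ring_1 \<Rightarrow> 'a::ab_group_add \<Rightarrow> 'a"
  assumes "module scale" "bilinear_op (fps_scale scale) mul"
  shows "bilinear_op scale (\<lambda>a b. fps_nth (mul (fps_const a) (fps_const b)) n)"
proof -
  have c: "fps_const (scale r a) = fps_scale scale (fps_const r) (fps_const a)" for r a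
    by (rule fps_ext) (simp add: fps_nth_fps_scale_const[OF assms(1)] module.scale_zero_right[OF assms(1)])
  show ?thesis
    by (rule bilinear_opI[OF assms(1)])
      (simp_all add: c bilinear_op_simps[OF assms(2)] fps_nth_fps_scale_const[OF assms(1)]
        del: fps_const_add flip: fps_const_add)
qed

lemma fps_eq_const_plus_X_shift:
  assumes "module scale"
  shows "X = fps_const (fps_nth X 0) + fps_scale scale fps_X (fps_shift 1 X)"
  using fps_nth_fps_scale_X_power[OF assms, of 1 1] module.scale_one[OF assms]
  by (intro fps_ext) auto

text \<open>Each series is its constant term plus a multiple of \<open>fps_X\<close>, and by
  bilinearity such multiples do not reach the constant term of the product.\<close>

lemma fps_nth_0_bilinear:
  fixes scale :: "'r::comm_ring_1 \<Rightarrow> 'a::ab_group_add \<Rightarrow> 'a"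
  assumes m: "module scale" and mul: "bilinear_op (fps_scale scale) mul"
  shows "fps_nth (mul X Y) 0 = fps_nth (mul (fps_const (fps_nth X 0)) (fps_const (fps_nth Y 0))) 0"
proof -
  have 0: "fps_nth (fps_scale scale fps_X Z) 0 = 0" for Z
    using fps_nth_fps_scale_X_power[OF m, of 1 1 Z 0] by simp
  have "fps_nth (mul X Y) 0 = fps_nth (mul (fps_const (fps_nth X 0)) Y) 0"
    by (subst fps_eq_const_plus_X_shift[OF m, of X]) (simp add: bilinear_op_simps[OF mul] 0)
  also have "\<dots> = fps_nth (mul (fps_const (fps_nth X 0)) (fps_const (fps_nth Y 0))) 0"
    by (subst fps_eq_const_plus_X_shift[OF m, of Y]) (simp add: bilinear_op_simps[OF mul] 0)
  finally show ?thesis .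
qed

text \<open>A multiple of \<open>fps_X\<close> in either argument contributes to coefficient 1 only
  the constant term of a product, which is zero here.\<close>

lemma fps_nth_1_bilinear:
  fixes scale :: "'r::comm_ring_1 \<Rightarrow> 'a::ab_group_add \<Rightarrow> 'a"
  assumes m: "module scale" and mul: "bilinear_op (fps_scale scale) mul" and 0: "\<And>X Y. fps_nth (mul X Y) 0 = 0"
  shows "fps_nth (mul X Y) 1 = fps_nth (mul (fps_const (fps_nth X 0)) (fps_const (fps_nth Y 0))) 1"
proof -
  have 1: "fps_nth (fps_scale scale fps_X Z) 1 = fps_nth Z 0" for Z
    using fps_nth_fps_scale_X_power[OF m, of 1 1 Z 1] module.scale_one[OF m] by simp
  have "fps_nth (mul X Y) 1 = fps_nth (mul (fps_const (fps_nth X 0)) Y) 1"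
    by (subst fps_eq_const_plus_X_shift[OF m, of X]) (simp add: bilinear_op_simps[OF mul] 1[simplified] 0)
  also have "\<dots> = fps_nth (mul (fps_const (fps_nth X 0)) (fps_const (fps_nth Y 0))) 1"
    by (subst fps_eq_const_plus_X_shift[OF m, of Y]) (simp add: bilinear_op_simps[OF mul] 1[simplified] 0)
  finally show ?thesis .
qed

section \<open>The infinitesimal algebra of a deformation\<close>

lemma ul_dend_cat_infinitesimal:
  fixes Rs :: "(unit, 'r::comm_ring_1) rel set" and scale :: "'r \<Rightarrow> 'a::ab_group_add \<Rightarrow> 'a"
  assumes two: "(2::'r) dvd 1"
    and comm: "comm_dendriform Rs scale prec0 succ0"
    and deform: "formal_deformation Rs scale prec0 succ0 prec succ"
  shows "ul_dend_cat Rs scale succ0 (infinitesimal_op scale prec succ)"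
proof -
  from two obtain h :: 'r where h: "h + h = 1" by (metis dvdE mult_2)
  have succ0: "bilinear_op scale succ0" and prec0: "prec0 a b = succ0 b a" for a b
    using comm by (auto simp: comm_dendriform_def dendriform_def)
  have m: "module scale" by (rule bilinear_op_module[OF succ0])
  have prec: "bilinear_op (fps_scale scale) prec" and succ: "bilinear_op (fps_scale scale) succ"
    and sat: "P \<in> Rs \<Longrightarrow> satisfies (prod_scale (fps_scale scale)) (\<lambda>_. box_prod prec succ)
      (Poly_Mapping.map fps_const P)"
    and succ_0: "fps_nth (succ (fps_const a) (fps_const b)) 0 = succ0 a b"
    and prec_0: "fps_nth (prec (fps_const a) (fps_const b)) 0 = succ0 b a" for P a b
    using deform by (auto simp: formal_deformation_def dendriform_def alg_cat_def prec0)
  interpret M: module "fps_scale scale" by (rule bilinear_op_module[OF succ])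
  let ?s = "\<lambda>r. fps_scale scale (fps_const r)"
  have half: "?s h X + ?s h X = X" for X
    using M.scale_left_distrib[of "fps_const h" "fps_const h" X] h by simp

  \<comment> \<open>The polarization of the deformed product: \<open>\<boxtimes>\<close> is the sum of \<open>\<odot>\<close> and \<open>\<lbrakk>,\<rbrakk>\<close>.\<close>
  define star where "star = (\<lambda>X Y. ?s h (succ X Y + prec Y X))"
  define circ where "circ = (\<lambda>X Y. ?s h (succ X Y - prec Y X))"
  note simps = bilinear_op_simps[OF prec] bilinear_op_simps[OF succ]
  have star: "bilinear_op (fps_scale scale) star" and circ: "bilinear_op (fps_scale scale) circ"
    unfolding star_def circ_def
    by (rule bilinear_opI[OF M.module_axioms]; simp add: simps M.scale_right_distrib
        M.scale_right_diff_distrib M.scale_left_commute algebra_simps)+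
  note star' = bilinear_op_restrict_scalars[OF star] and circ' = bilinear_op_restrict_scalars[OF circ]
  have plus: "star X Y + circ X Y = succ X Y" "star X Y - circ X Y = prec Y X" for X Y
  proof -
    have "star X Y + circ X Y = ?s h (succ X Y) + ?s h (succ X Y)"
      "star X Y - circ X Y = ?s h (prec Y X) + ?s h (prec Y X)"
      by (simp_all add: star_def circ_def M.scale_right_distrib M.scale_right_diff_distrib)
    then show "star X Y + circ X Y = succ X Y" "star X Y - circ X Y = prec Y X"
      by (simp_all add: half)
  qed
  have box: "box_prod prec succ u v = sq_dot star u v + sq_br circ u v" for u v
    by (cases u; cases v) (simp add: plus[symmetric] algebra_simps)

  have satisfies: "satisfies ?s (case_dend_op star circ) Q" if "Q \<in> dend_relations Rs" for Q
  proof -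
    have "satisfies (prod_scale ?s) (sq star circ) (pol_rel P)" if P: "P \<in> Rs" for P
    proof -
      \<comment> \<open>\<open>fps_const\<close> sends nonzero coefficients to nonzero ones, so both
        relations have the same support and can be compared term by term.\<close>
      have keys: "Poly_Mapping.keys (Poly_Mapping.map fps_const P) = Poly_Mapping.keys P"
        by (auto simp: in_keys_iff Poly_Mapping.map.rep_eq when_def)
      have "eval (prod_scale ?s) (\<lambda>_. box_prod prec succ) \<rho> P
          = eval (prod_scale (fps_scale scale)) (\<lambda>_. box_prod prec succ) \<rho> (Poly_Mapping.map fps_const P)" for \<rho>
        unfolding eval_def keys
        by (intro sum.cong refl) (simp add: prod_scale_def Poly_Mapping.map.rep_eq when_def in_keys_iff)
      then have "eval (prod_scale ?s) (\<lambda>_. box_prod prec succ) \<rho> P = 0" for \<rho>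
        using sat[OF P] by (simp add: satisfies_def)
      moreover have "(\<lambda>(_::unit) u v. sq_dot star u v + sq_br circ u v) = (\<lambda>_. box_prod prec succ)"
        by (simp add: fun_eq_iff box)
      ultimately show ?thesis
        using eval_pol_rel[of "prod_scale ?s" "sq star circ", OF bilinear_sq[OF star' circ'] bilinear_sq[OF star' circ']]
        by (simp add: satisfies_def)
    qed
    then have "satisfies ?s (case_dend_op star circ) Q" if "Q \<in> (\<Union>P\<in>Rs. dend_rels (pol_rel P))" for Q
      using that satisfies_dend_rels_iff[OF star' circ'] by blast
    with \<open>Q \<in> dend_relations Rs\<close> show ?thesis
      unfolding dend_relations_def
      by (rule satisfies_rel_space[OF bilinear_case_dend_op[OF star' circ'], rotated])
  qed

  have star_0: "fps_nth (star X Y) 0 = succ0 (fps_nth X 0) (fps_nth Y 0)" for X Y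
  proof -
    have "scale h a + scale h a = a" for a
      using module.scale_left_distrib[OF m, of h h a] module.scale_one[OF m] h by simp
    then show ?thesis
      by (subst fps_nth_0_bilinear[OF m star])
        (simp add: star_def fps_nth_fps_scale_const[OF m] succ_0 prec_0 module.scale_right_distrib[OF m])
  qed
  \<comment> \<open>The undeformed algebra is commutative dendriform, so the two constant terms
    cancel.\<close>
  have circ_0: "fps_nth (circ X Y) 0 = 0" for X Y
    by (subst fps_nth_0_bilinear[OF m circ])
      (simp add: circ_def fps_nth_fps_scale_const[OF m] succ_0 prec_0 module.scale_zero_right[OF m])
  have inf: "infinitesimal_op scale prec succ a b = fps_nth (circ (fps_const a) (fps_const b)) 1" for a b
  proof -
    let ?D = "succ (fps_const a) (fps_const b) - prec (fps_const b) (fps_const a)"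
    \<comment> \<open>The equation under \<open>THE\<close> has exactly one solution:
      \<open>?D\<close> has zero constant term, so it is divisible by \<open>fps_X\<close>, and the
      factor 2 is undone by \<open>h\<close>.\<close>
    have two_X: "fps_scale scale (2 * fps_X) Y = ?D \<longleftrightarrow> Y = ?s h (fps_shift 1 ?D)" for Y
    proof -
      have two_X: "fps_nth (fps_scale scale (2 * fps_X) Y) n = (if n < 1 then 0 else scale 2 (fps_nth Y (n - 1)))" for n
        using fps_nth_fps_scale_X_power[OF m, of 2 1 Y n] by (simp add: numeral_fps_const)
      have all_nat_split: "(\<forall>n. \<Phi> n) \<longleftrightarrow> \<Phi> 0 \<and> (\<forall>n. \<Phi> (Suc n))" for \<Phi> :: "nat \<Rightarrow> bool"
        by (metis not0_implies_Suc)
      have "fps_nth ?D 0 = 0" by (simp add: succ_0 prec_0)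
      then have "fps_scale scale (2 * fps_X) Y = ?D \<longleftrightarrow> (\<forall>n. scale 2 (fps_nth Y n) = fps_nth ?D (Suc n))"
        unfolding fps_eq_iff by (subst all_nat_split) (simp add: two_X)
      also have "\<dots> \<longleftrightarrow> (\<forall>n. fps_nth Y n = scale h (fps_nth ?D (Suc n)))"
      proof -
        have "2 * h = 1" "h * 2 = 1" using h by (simp_all only: mult_2 mult_2_right)
        then have "scale 2 (scale h c) = c" "scale h (scale 2 c) = c" for c
          by (simp_all add: module.scale_scale[OF m] module.scale_one[OF m])
        then have "scale 2 b = c \<longleftrightarrow> b = scale h c" for b c by fastforce
        then show ?thesis by blast
      qed
      also have "\<dots> \<longleftrightarrow> Y = ?s h (fps_shift 1 ?D)"
        by (simp add: fps_eq_iff fps_nth_fps_scale_const[OF m])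
      finally show ?thesis .
    qed
    show ?thesis
      unfolding infinitesimal_op_def two_X
      by (simp add: circ_def fps_nth_fps_scale_const[OF m])
  qed
  have bullet: "bilinear_op scale (infinitesimal_op scale prec succ)"
    using bilinear_op_fps_nth[OF m circ, of 1] by (simp add: inf[abs_def])

  let ?v\<nu> = "\<lambda>\<rho>. mono_val (case_dend_op star circ) (\<lambda>i. fps_const (\<rho> i))"
  let ?v = "mono_val (case_dend_op succ0 (infinitesimal_op scale prec succ))"
  have lead: "\<exists>X. ?v\<nu> \<rho> t = fps_scale scale (fps_X ^ weight Circ t) X \<and> fps_nth X 0 = ?v \<rho> t" for \<rho> t
  proof (induction t)
    case (Var i)
    show ?case by (intro exI[of _ "fps_const (\<rho> i)"]) simp
  next
    case (Prod q s t)
    then obtain X Y where XY: "?v\<nu> \<rho> s = fps_scale scale (fps_X ^ weight Circ s) X" "fps_nth X 0 = ?v \<rho> s"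
      "?v\<nu> \<rho> t = fps_scale scale (fps_X ^ weight Circ t) Y" "fps_nth Y 0 = ?v \<rho> t"
      by blast
    show ?case
    proof (cases q)
      case Star
      then show ?thesis
        by (intro exI[of _ "star X Y"])
          (simp add: XY bilinear_op_simps[OF star] power_add star_0 mult.commute)
    next
      case Circ
      \<comment> \<open>The missing constant term supplies one more factor \<open>fps_X\<close> for
        the additional \<open>Circ\<close>. The quotient has as its constant term coefficient 1 of
        \<open>circ X Y\<close>, which is the infinitesimal product.\<close>
      have "circ X Y = fps_scale scale fps_X (fps_shift 1 (circ X Y))"
        using fps_eq_const_plus_X_shift[OF m, of "circ X Y"] by (simp add: circ_0)
      then have "fps_scale scale c (circ X Y) = fps_scale scale (c * fps_X) (fps_shift 1 (circ X Y))" for c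
        by (metis M.scale_scale)
      then show ?thesis
        using Circ fps_nth_1_bilinear[OF m circ circ_0, of X Y]
        by (intro exI[of _ "fps_shift 1 (circ X Y)"])
          (simp add: XY bilinear_op_simps[OF circ] power_add inf mult_ac)
    qed
  qed
  \<comment> \<open>Only coefficients up to the weight are determined by the infinitesimal algebra;
    higher ones depend on the rest of the deformation.\<close>
  have v_nth: "fps_nth (?v\<nu> \<rho> t) k = (if k < weight Circ t then 0 else ?v \<rho> t)" if "k \<le> weight Circ t" for \<rho> t k
    using lead[of \<rho> t] that fps_nth_fps_scale_X_power[OF m, of 1 "weight Circ t"] module.scale_one[OF m]
    by auto

  have "satisfies scale (case_dend_op succ0 (infinitesimal_op scale prec succ)) (lowest_part Circ {0} Q)"
    if Q: "Q \<in> dend_relations Rs" for Q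
  proof (cases "Q = 0")
    case True
    then show ?thesis by (simp add: lowest_part_def satisfies_def eval_def)
  next
    case False
    then have "Q \<notin> {0}" by simp
    then obtain k where low: "lowest_part Circ {0} Q = weight_part Circ k Q"
      and less: "\<And>j. j < k \<Longrightarrow> weight_part Circ j Q = 0"
      by (rule lowest_partE[OF free.subspace_single_0]) blast
    have k_le: "k \<le> weight Circ t" if "t \<in> Poly_Mapping.keys Q" for t
    proof (rule ccontr)
      assume "\<not> k \<le> weight Circ t"
      then have "restr (\<lambda>u. weight Circ u = weight Circ t) Q = 0"
        using less[of "weight Circ t"] by (simp add: weight_part_eq_restr)
      then show False using that keys_restr[of "\<lambda>u. weight Circ u = weight Circ t" Q] by auto
    qed
    have "eval scale (case_dend_op succ0 (infinitesimal_op scale prec succ)) \<rho> (weight_part Circ k Q) = 0" for \<rho>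
    proof -
      have "eval scale (case_dend_op succ0 (infinitesimal_op scale prec succ)) \<rho> (weight_part Circ k Q)
          = (\<Sum>t\<in>Poly_Mapping.keys Q. scale (Poly_Mapping.lookup (weight_part Circ k Q) t) (?v \<rho> t))"
        by (rule eval_superset[OF m]) (auto simp: weight_part_eq_restr keys_restr)
      \<comment> \<open>All monomials of \<open>Q\<close> have weight at least \<open>k\<close>.
        Those of larger weight contribute zero to coefficient \<open>k\<close>, and those of weight
        \<open>k\<close> contribute their infinitesimal values.\<close>
      also have "\<dots> = (\<Sum>t\<in>Poly_Mapping.keys Q. scale (Poly_Mapping.lookup Q t) (fps_nth (?v\<nu> \<rho> t) k))"
        by (intro sum.cong refl) (auto dest!: k_le simp: v_nth weight_part_eq_restr lookup_restr
            module.scale_zero_left[OF m] module.scale_zero_right[OF m])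
      also have "\<dots> = fps_nth (eval ?s (case_dend_op star circ) (\<lambda>i. fps_const (\<rho> i)) Q) k"
        by (simp add: eval_def fps_sum_nth fps_nth_fps_scale_const[OF m])
      also have "\<dots> = 0"
        using satisfies[OF Q] by (simp add: satisfies_def)
      finally show ?thesis .
    qed
    then show ?thesis by (simp add: low satisfies_def)
  qed
  with succ0 bullet show ?thesis by (simp add: ul_dend_cat_def)
qed

theorem proposition4p13:
  fixes Rs :: "(unit, 'r::comm_ring_1) rel set"
    and scale :: "'r \<Rightarrow> 'a::ab_group_add \<Rightarrow> 'a"
    and prec0 succ0 :: "'a \<Rightarrow> 'a \<Rightarrow> 'a"
    and prec succ :: "'a fps \<Rightarrow> 'a fps \<Rightarrow> 'a fps"
  assumes two_invertible: "(2::'r) dvd 1"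
    and finite_Rs: "finite Rs"
  shows
    "(comm_dendriform Rs scale prec0 succ0 \<and> formal_deformation Rs scale prec0 succ0 prec succ \<longrightarrow>
        ul_dend_cat Rs scale succ0 (infinitesimal_op scale prec succ) \<and>
        (weight_generated (dend_relations Rs) \<longrightarrow>
           pol_dend (pol_cat Rs) scale succ0 (infinitesimal_op scale prec succ)) \<and>
        ((\<forall>P\<in>Rs. multilinear P) \<longrightarrow>
           pol_dend (ul_pol_cat Rs) scale succ0 (infinitesimal_op scale prec succ))) \<and>
     ((\<forall>P\<in>Rs. multilinear P) \<longrightarrow>
        (ul_dend_cat Rs :: ('r \<Rightarrow> 'b::ab_group_add \<Rightarrow> 'b) \<Rightarrow> ('b \<Rightarrow> 'b \<Rightarrow> 'b) \<Rightarrow> ('b \<Rightarrow> 'b \<Rightarrow> 'b) \<Rightarrow> bool)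
          = pol_dend (ul_pol_cat Rs))"
proof (intro conjI impI)
  assume "comm_dendriform Rs scale prec0 succ0 \<and> formal_deformation Rs scale prec0 succ0 prec succ"
  then show cat: "ul_dend_cat Rs scale succ0 (infinitesimal_op scale prec succ)"
    using ul_dend_cat_infinitesimal[OF two_invertible] by blast
  show "pol_dend (pol_cat Rs) scale succ0 (infinitesimal_op scale prec succ)"
    if "weight_generated (dend_relations Rs)"
    using cat satisfies_dend_relations_if_weight_generated[OF cat that]
    by (intro pol_dend_pol_cat_if_dend_relations) (auto simp: ul_dend_cat_def)
  show "pol_dend (ul_pol_cat Rs) scale succ0 (infinitesimal_op scale prec succ)"
    if "\<forall>P\<in>Rs. multilinear P"
    using cat ul_dend_cat_eq_pol_dend[OF two_invertible that] by blast
next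
  assume "\<forall>P\<in>Rs. multilinear P"
  then show "(ul_dend_cat Rs :: ('r \<Rightarrow> 'b \<Rightarrow> 'b) \<Rightarrow> ('b \<Rightarrow> 'b \<Rightarrow> 'b) \<Rightarrow> ('b \<Rightarrow> 'b \<Rightarrow> 'b) \<Rightarrow> bool)
      = pol_dend (ul_pol_cat Rs)"
    using ul_dend_cat_eq_pol_dend[OF two_invertible] by (intro ext) blast
qed

end
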